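(* Let $G$ be a $4$-regular graph with $\chi'(G)=4$. Then every proper $5$-edge coloring of $G$ can be transformed to any proper $4$-edge coloring of $G$ by a sequence of interchanges.
   Context: All graphs are finite, without loops and multiple edges. A proper $t$-edge coloring of $G$ is a map $f:E(G)\to\{1,\dots,t\}$ with $f(e)\neq f(e')$ for adjacent edges $e,e'$; $\chi'(G)$ is the least $t$ admitting one. A proper $4$-edge coloring is regarded as a proper $5$-edge coloring not using color $5$. For a proper edge coloring $f$ and colors $a,b$, $G_f(a,b)$ is the subgraph induced by the edges colored $a$ or $b$. An interchange (Kempe change) consists of swapping colors $a$ and $b$ on one connected component of $G_f(a,b)$. *)

theory Defs
  imports Main
begin

text \<open>A finite simple graph: vertex set V, edge set E of 2-element subsets of V.\<close>
definition simple_graph :: "'a set \<Rightarrow> 'a set set \<Rightarrow> bool" where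
  "simple_graph V E \<longleftrightarrow> finite V \<and>
     (\<forall>e\<in>E. \<exists>u v. u \<noteq> v \<and> u \<in> V \<and> v \<in> V \<and> e = {u, v})"

definition degree :: "'a set set \<Rightarrow> 'a \<Rightarrow> nat" where
  "degree E v = card {e\<in>E. v \<in> e}"

definition regular :: "'a set \<Rightarrow> 'a set set \<Rightarrow> nat \<Rightarrow> bool" where
  "regular V E k \<longleftrightarrow> (\<forall>v\<in>V. degree E v = k)"

text \<open>Two distinct edges are adjacent if they share an end vertex.\<close>
definition adj_edges :: "'a set \<Rightarrow> 'a set \<Rightarrow> bool" where
  "adj_edges e e' \<longleftrightarrow> e \<noteq> e' \<and> e \<inter> e' \<noteq> {}"

text \<open>Proper t-edge coloring with colors 1..t (values off E are irrelevant).\<close>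
definition proper_edge_coloring :: "'a set set \<Rightarrow> nat \<Rightarrow> ('a set \<Rightarrow> nat) \<Rightarrow> bool" where
  "proper_edge_coloring E t f \<longleftrightarrow>
     (\<forall>e\<in>E. f e \<in> {1..t}) \<and>
     (\<forall>e\<in>E. \<forall>e'\<in>E. adj_edges e e' \<longrightarrow> f e \<noteq> f e')"

definition chromatic_index :: "'a set set \<Rightarrow> nat" where
  "chromatic_index E = (LEAST t. \<exists>f. proper_edge_coloring E t f)"

text \<open>Edge set of G_f(a,b).\<close>
definition two_col_edges :: "'a set set \<Rightarrow> ('a set \<Rightarrow> nat) \<Rightarrow> nat \<Rightarrow> nat \<Rightarrow> 'a set set" where
  "two_col_edges E f a b = {e\<in>E. f e = a \<or> f e = b}"

text \<open>The edge set of the connected component of G_f(a,b) containing edge e0.\<close>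
definition kempe_component ::
  "'a set set \<Rightarrow> ('a set \<Rightarrow> nat) \<Rightarrow> nat \<Rightarrow> nat \<Rightarrow> 'a set \<Rightarrow> 'a set set" where
  "kempe_component E f a b e0 =
     {e. ((\<lambda>x y. x \<in> two_col_edges E f a b \<and> y \<in> two_col_edges E f a b \<and> adj_edges x y)\<^sup>*\<^sup>*)
           e0 e \<and> e \<in> two_col_edges E f a b}"

definition swap_col :: "nat \<Rightarrow> nat \<Rightarrow> nat \<Rightarrow> nat" where
  "swap_col a b c = (if c = a then b else if c = b then a else c)"

text \<open>One interchange (Kempe change) of a coloring using colors from 1..t:
  swap colors a and b on one component (containing edge e0) of G_f(a,b).
  Components without edges (isolated vertices) produce no change and are omitted.\<close>
definition interchange :: "'a set set \<Rightarrow> nat \<Rightarrow> ('a set \<Rightarrow> nat) \<Rightarrow> ('a set \<Rightarrow> nat) \<Rightarrow> bool" where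
  "interchange E t f f' \<longleftrightarrow>
     (\<exists>a b e0. a \<in> {1..t} \<and> b \<in> {1..t} \<and> e0 \<in> two_col_edges E f a b \<and>
        f' = (\<lambda>e. if e \<in> kempe_component E f a b e0 then swap_col a b (f e) else f e))"

end

theory Submission
  imports Defs
begin

text \<open>Induct on the degree k for k-regular graphs coloured with k + 1 colours. Let M be a colour
  class j of the target; it is a perfect matching. If the given colouring can be moved so that its
  class j is exactly M, delete M together with the colour j and recurse.

  Every vertex misses exactly one colour. Choose a reachable colouring with as many edges of M
  coloured j as possible. Suppose a vertex u misses j, with uv in M of colour a. Unless the edge uv
  can be recoloured at once, v has an edge vw of colour j. Let w miss b and v miss d, and let s, p, z
  be the neighbours of w along the colours a, d and the fifth colour c. Maximality, applied also
  after Kempe changes that avoid j, forces a, b, d, j to be distinct and s to miss c. The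
  neighbour t of s along j then misses a: otherwise it can be made to miss c, st is recoloured c, and
  flipping the path u, v, w, s leads to an equally good colouring in which the colour missing at z is
  contradictory. Finally p and z must both be u or t. As uv and st lie in M, the matching M cannot
  cover w.

  So no vertex misses j, and if class j differs from M, then some edge of colour j lies outside M. A
  fan at one of its ends that cannot be shifted would need a sixth colour, so that edge can be given
  another colour; this makes its ends miss j, which was just excluded.\<close>

section \<open>Kempe changes on unions of components\<close>

definition coloring :: "'a set set \<Rightarrow> nat set \<Rightarrow> ('a set \<Rightarrow> nat) \<Rightarrow> bool" where
  "coloring E C f \<longleftrightarrow> (\<forall>e\<in>E. f e \<in> C) \<and> (\<forall>e\<in>E. \<forall>e'\<in>E. adj_edges e e' \<longrightarrow> f e \<noteq> f e')"

definition flip :: "nat \<Rightarrow> nat \<Rightarrow> 'a set set \<Rightarrow> ('a set \<Rightarrow> nat) \<Rightarrow> 'a set \<Rightarrow> nat" where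
  "flip a b S f = (\<lambda>e. if e \<in> S then swap_col a b (f e) else f e)"

text \<open>Colours come from an arbitrary set \<open>C\<close> instead of an initial segment,
  because the induction on the degree deletes an arbitrary colour.\<close>

definition kempe_step :: "'a set set \<Rightarrow> nat set \<Rightarrow> ('a set \<Rightarrow> nat) \<Rightarrow> ('a set \<Rightarrow> nat) \<Rightarrow> bool" where
  "kempe_step E C f f' \<longleftrightarrow>
     (\<exists>a\<in>C. \<exists>b\<in>C. \<exists>e\<in>two_col_edges E f a b. f' = flip a b (kempe_component E f a b e) f)"

text \<open>Closed sets are the unions of components. Working with them avoids having to show that an
  explicitly given path is connected.\<close>
definition kempe_closed :: "'a set set \<Rightarrow> ('a set \<Rightarrow> nat) \<Rightarrow> nat \<Rightarrow> nat \<Rightarrow> 'a set set \<Rightarrow> bool" where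
  "kempe_closed E f a b S \<longleftrightarrow> S \<subseteq> two_col_edges E f a b \<and>
     (\<forall>e\<in>S. \<forall>e'\<in>two_col_edges E f a b. e \<inter> e' \<noteq> {} \<longrightarrow> e' \<in> S)"

lemma interchange_eq_kempe_step: "interchange E t = kempe_step E {1..t}"
  unfolding interchange_def kempe_step_def flip_def fun_eq_iff by blast

lemma proper_edge_coloring_eq_coloring: "proper_edge_coloring E t = coloring E {1..t}"
  unfolding proper_edge_coloring_def coloring_def fun_eq_iff by blast

lemma flip_empty: "flip a b {} f = f"
  by (simp add: flip_def)

lemma flip_insert: "flip a b (insert e S) f = (flip a b S f)(e := swap_col a b (f e))"
  by (auto simp: flip_def fun_eq_iff)

lemma two_col_edges_flip:
  assumes "S \<subseteq> two_col_edges E f a b"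
  shows "two_col_edges E (flip a b S f) a b = two_col_edges E f a b"
  using assms unfolding two_col_edges_def flip_def swap_col_def by auto

lemma kempe_component_refl:
  "e \<in> two_col_edges E f a b \<Longrightarrow> e \<in> kempe_component E f a b e"
  unfolding kempe_component_def by simp

lemma kempe_component_subset: "kempe_component E f a b e \<subseteq> two_col_edges E f a b"
  unfolding kempe_component_def by blast

lemma kempe_closed_component: "kempe_closed E f a b (kempe_component E f a b e0)"
  unfolding kempe_closed_def
proof (intro conjI ballI impI kempe_component_subset)
  fix e e'
  assume e: "e \<in> kempe_component E f a b e0" and e': "e' \<in> two_col_edges E f a b" "e \<inter> e' \<noteq> {}"
  show "e' \<in> kempe_component E f a b e0"
  proof (cases "e = e'")
    case False
    then have "adj_edges e e'" using e' by (simp add: adj_edges_def)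
    then show ?thesis
      using e e' unfolding kempe_component_def by (auto intro: rtranclp.rtrancl_into_rtrancl)
  qed (use e in simp)
qed

lemma kempe_component_least:
  assumes "kempe_closed E f a b S" "e0 \<in> S"
  shows "kempe_component E f a b e0 \<subseteq> S"
proof
  fix e
  assume "e \<in> kempe_component E f a b e0"
  then have "(\<lambda>x y. x \<in> two_col_edges E f a b \<and> y \<in> two_col_edges E f a b \<and> adj_edges x y)\<^sup>*\<^sup>* e0 e"
    unfolding kempe_component_def by simp
  then show "e \<in> S"
  proof induction
    case (step y z)
    then show ?case using assms(1) unfolding kempe_closed_def adj_edges_def by blast
  qed (fact assms(2))
qed

text \<open>Flip one component \<open>K\<close> inside \<open>S\<close> and induct. The flip leaves
  the set of edges coloured \<open>a\<close> or \<open>b\<close> unchanged, so \<open>S - K\<close>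
  is again a union of components, now of the new colouring.\<close>

lemma kempe_closed_reachable:
  assumes "finite S" "kempe_closed E f a b S" "a \<in> C" "b \<in> C"
  shows "(kempe_step E C)\<^sup>*\<^sup>* f (flip a b S f)"
  using assms(1,2)
proof (induction S arbitrary: f rule: finite_psubset_induct)
  case (psubset S)
  show ?case
  proof (cases "S = {}")
    case True
    then show ?thesis by (simp add: flip_def)
  next
    case False
    then obtain e0 where e0: "e0 \<in> S" by blast
    define K where "K = kempe_component E f a b e0"
    define f1 where "f1 = flip a b K f"
    have sub: "S \<subseteq> two_col_edges E f a b"
      using psubset.prems by (simp add: kempe_closed_def)
    have e0': "e0 \<in> two_col_edges E f a b" using e0 sub by blast
    have KS: "K \<subseteq> S" unfolding K_def by (rule kempe_component_least[OF psubset.prems e0])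
    have eK: "e0 \<in> K" unfolding K_def by (rule kempe_component_refl[OF e0'])
    have Kc: "kempe_closed E f a b K" unfolding K_def by (rule kempe_closed_component)
    have tc: "two_col_edges E f1 a b = two_col_edges E f a b"
      unfolding f1_def by (rule two_col_edges_flip) (use KS sub in blast)
    have "kempe_step E C f f1"
      unfolding kempe_step_def f1_def K_def using assms(3,4) e0' by blast
    moreover have "(kempe_step E C)\<^sup>*\<^sup>* f1 (flip a b (S - K) f1)"
    proof (rule psubset.IH)
      show "S - K \<subset> S" using e0 eK by blast
      show "kempe_closed E f1 a b (S - K)"
        unfolding kempe_closed_def tc
      proof (intro conjI ballI impI)
        fix e e'
        assume "e \<in> S - K" "e' \<in> two_col_edges E f a b" "e \<inter> e' \<noteq> {}"
        moreover have "e' \<in> S"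
          using calculation psubset.prems unfolding kempe_closed_def by blast
        moreover have "e' \<notin> K"
          using calculation Kc sub unfolding kempe_closed_def by blast
        ultimately show "e' \<in> S - K" by blast
      qed (use sub in blast)
    qed
    moreover have "flip a b (S - K) f1 = flip a b S f"
      unfolding f1_def flip_def using KS by (auto simp: fun_eq_iff)
    ultimately show ?thesis by (metis converse_rtranclp_into_rtranclp)
  qed
qed

text \<open>At an edge of \<open>S\<close>, every adjacent edge coloured \<open>a\<close> or
  \<open>b\<close> is in \<open>S\<close> too, so both colours are swapped together; any other
  adjacent colour is outside \<open>{a, b}\<close>.\<close>

lemma coloring_flip:
  assumes "coloring E C f" "kempe_closed E f a b S" "a \<in> C" "b \<in> C"
  shows "coloring E C (flip a b S f)"
proof -
  have "flip a b S f e \<in> C" if "e \<in> E" for e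
    using assms that unfolding coloring_def flip_def swap_col_def by auto
  moreover have "flip a b S f e \<noteq> flip a b S f e'" if "e \<in> E" "e' \<in> E" "adj_edges e e'" for e e'
  proof -
    have ne: "f e \<noteq> f e'" using assms(1) that by (simp add: coloring_def)
    have mem: "e' \<in> S" if "e \<in> S" "f e' \<in> {a, b}"
      using assms(2) that \<open>e' \<in> E\<close> \<open>adj_edges e e'\<close>
      unfolding kempe_closed_def two_col_edges_def adj_edges_def by blast
    have mem': "e \<in> S" if "e' \<in> S" "f e \<in> {a, b}"
      using assms(2) that \<open>e \<in> E\<close> \<open>adj_edges e e'\<close>
      unfolding kempe_closed_def two_col_edges_def adj_edges_def by blast
    have "f e \<in> {a, b}" if "e \<in> S" for e
      using assms(2) that unfolding kempe_closed_def two_col_edges_def by blast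
    then show ?thesis
      using ne mem mem' unfolding flip_def swap_col_def by (smt (verit) insert_iff singletonD)
  qed
  ultimately show ?thesis by (simp add: coloring_def)
qed

lemma kempe_step_coloring:
  "coloring E C f \<Longrightarrow> kempe_step E C f f' \<Longrightarrow> coloring E C f'"
  unfolding kempe_step_def using coloring_flip kempe_closed_component by blast

lemma kempe_reachable_coloring:
  "(kempe_step E C)\<^sup>*\<^sup>* f f' \<Longrightarrow> coloring E C f \<Longrightarrow> coloring E C f'"
  by (induction rule: rtranclp_induct) (auto intro: kempe_step_coloring)

section \<open>The ends of a two-coloured component\<close>

lemma rtranclp_functional_linear:
  assumes "r\<^sup>*\<^sup>* s t" "r\<^sup>*\<^sup>* s t'" "\<And>x y z. r x y \<Longrightarrow> r x z \<Longrightarrow> y = z"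
  shows "r\<^sup>*\<^sup>* t t' \<or> r\<^sup>*\<^sup>* t' t"
  using assms(1,2)
proof (induction arbitrary: rule: converse_rtranclp_induct)
  case (step x y)
  then show ?case
    by (metis assms(3) converse_rtranclpE converse_rtranclp_into_rtranclp)
qed blast

text \<open>Walking along the component from one end is deterministic, so the walk can stop at one
  other vertex only.\<close>
lemma kempe_component_ends:
  fixes f :: "'a set \<Rightarrow> nat" and E :: "'a set set" and a b :: nat
  defines "H \<equiv> two_col_edges E f a b"
  assumes two: "\<And>e. e \<in> E \<Longrightarrow> \<exists>p q. p \<noteq> q \<and> e = {p, q}"
    and deg2: "\<And>x e1 e2 e3. e1 \<in> H \<Longrightarrow> e2 \<in> H \<Longrightarrow> e3 \<in> H \<Longrightarrow> x \<in> e1 \<Longrightarrow> x \<in> e2 \<Longrightarrow> x \<in> e3 \<Longrightarrow>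
          e1 = e2 \<or> e1 = e3 \<or> e2 = e3"
    and e0: "e0 \<in> H" "x \<in> e0"
    and ends: "\<And>e e' v. v \<in> {x, y, z} \<Longrightarrow> e \<in> H \<Longrightarrow> e' \<in> H \<Longrightarrow> v \<in> e \<Longrightarrow> v \<in> e' \<Longrightarrow> e = e'"
    and y: "y \<noteq> x" "ey \<in> kempe_component E f a b e0" "y \<in> ey"
    and z: "z \<noteq> x" "ez \<in> kempe_component E f a b e0" "z \<in> ez"
  shows "y = z"
proof -
  \<comment> \<open>A state \<open>(v, e)\<close> is an edge \<open>e\<close> entered at its end
    \<open>v\<close>. A step crosses \<open>e\<close> and enters the next edge at the far end
    \<open>v'\<close>. Recording the direction is what makes the walk deterministic.\<close>
  define r where "r = (\<lambda>(v, e) (v', e'). e \<in> H \<and> e' \<in> H \<and> e = {v, v'} \<and> v \<noteq> v' \<and> e' \<noteq> e \<and> v' \<in> e')"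
  have HE: "H \<subseteq> E" unfolding H_def two_col_edges_def by blast
  have fn: "s = t" if "r p s" "r p t" for p s t
  proof -
    obtain v e v1 e1 v2 e2 where eq: "p = (v, e)" "s = (v1, e1)" "t = (v2, e2)"
      by (metis surj_pair)
    have *: "e \<in> H" "e1 \<in> H" "e2 \<in> H" "e = {v, v1}" "v \<noteq> v1" "e1 \<noteq> e" "v1 \<in> e1"
      "e = {v, v2}" "e2 \<noteq> e" "v2 \<in> e2"
      using that unfolding eq r_def by auto
    then have "v1 = v2" by (metis doubleton_eq_iff)
    moreover from this have "e1 = e2" using deg2[of e e1 e2 v1] * by auto
    ultimately show ?thesis using eq by simp
  qed
  \<comment> \<open>The walk from \<open>x\<close> visits the whole component. If an adjacent edge
    \<open>e'\<close> hangs at the entry end \<open>v\<close> of \<open>e\<close>, the walk has just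
    come through \<open>e'\<close>, as \<open>v\<close> has at most two edges in \<open>H\<close>;
    at the start \<open>x\<close> no such \<open>e'\<close> exists.\<close>
  have dart: "e \<in> H \<and> (\<exists>v. v \<in> e \<and> r\<^sup>*\<^sup>* (x, e0) (v, e))" if "e \<in> kempe_component E f a b e0" for e
  proof -
    have "(\<lambda>x y. x \<in> H \<and> y \<in> H \<and> adj_edges x y)\<^sup>*\<^sup>* e0 e"
      using that unfolding kempe_component_def H_def by simp
    then show ?thesis
    proof induction
      case base
      then show ?case using e0 by blast
    next
      case (step e e')
      then obtain v where v: "v \<in> e" "r\<^sup>*\<^sup>* (x, e0) (v, e)" by blast
      have eH: "e \<in> H" "e' \<in> H" "e \<noteq> e'" "e \<inter> e' \<noteq> {}"
        using step.hyps by (auto simp: adj_edges_def)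
      obtain v' where v': "e = {v, v'}" "v \<noteq> v'" using two[of e] eH HE v(1) by blast
      show ?case
      proof (cases "v' \<in> e'")
        case True
        then have "r (v, e) (v', e')" using eH v' unfolding r_def by auto
        then show ?thesis using v(2) eH True by (meson rtranclp.rtrancl_into_rtrancl)
      next
        case False
        then have ve': "v \<in> e'" using eH v' by blast
        from v(2) show ?thesis
        proof (cases rule: rtranclp.cases)
          case rtrancl_refl
          then show ?thesis using ends[of x e e'] eH v(1) ve' by auto
        next
          case (rtrancl_into_rtrancl p)
          then obtain v0 e1 where p: "p = (v0, e1)" by (cases p)
          then have "e1 \<in> H" "e1 = {v0, v}" "e1 \<noteq> e"
            using rtrancl_into_rtrancl unfolding r_def by auto
          then have "e1 = e'" using deg2[of e e' e1 v] eH v(1) ve' by auto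
          then show ?thesis using rtrancl_into_rtrancl(1) p \<open>e1 = {v0, v}\<close> eH by auto
        qed
      qed
    qed
  qed
  \<comment> \<open>An edge at \<open>y\<close> or \<open>z\<close> must be crossed towards that
    vertex: entering it there would require a second edge of \<open>H\<close> at an end. Afterwards
    the walk is stuck, so both final states coincide by determinism.\<close>
  have terminal: "\<exists>v. r\<^sup>*\<^sup>* (x, e0) (v, e) \<and> e = {v, t} \<and> v \<noteq> t \<and> (\<forall>s. \<not> r (v, e) s)"
    if t: "t \<in> {y, z}" "t \<noteq> x" "e \<in> kempe_component E f a b e0" "t \<in> e" for t e
  proof -
    obtain v where v: "v \<in> e" "r\<^sup>*\<^sup>* (x, e0) (v, e)" and eH: "e \<in> H" using dart[OF t(3)] by blast
    have "v \<noteq> t"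
    proof
      assume vt: "v = t"
      from v(2) show False
      proof (cases rule: rtranclp.cases)
        case rtrancl_refl
        then show False using vt t(2) by simp
      next
        case (rtrancl_into_rtrancl p)
        then obtain v0 e1 where p: "p = (v0, e1)" by (cases p)
        then have "e1 \<in> H" "e1 = {v0, v}" "e1 \<noteq> e"
          using rtrancl_into_rtrancl unfolding r_def by auto
        then show False using ends[of t e1 e] t(1,4) eH vt by auto
      qed
    qed
    moreover have "e = {v, t}" using two[of e] eH HE v(1) t(4) \<open>v \<noteq> t\<close> by blast
    moreover have "\<not> r (v, e) s" for s
    proof
      assume "r (v, e) s"
      then obtain v' e' where "e' \<in> H" "e = {v, v'}" "e' \<noteq> e" "v' \<in> e'"
        unfolding r_def by (cases s) auto
      then show False using ends[of t e e'] t(1) eH \<open>e = {v, t}\<close> \<open>v \<noteq> t\<close> by (auto simp: doubleton_eq_iff)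
    qed
    ultimately show ?thesis using v(2) by blast
  qed
  have "y \<in> {y, z}" "z \<in> {y, z}" by simp_all
  from terminal[OF this(1) y] obtain vy where
    vy: "r\<^sup>*\<^sup>* (x, e0) (vy, ey)" "ey = {vy, y}" "\<forall>s. \<not> r (vy, ey) s" by (elim exE conjE)
  from terminal[OF \<open>z \<in> {y, z}\<close> z] obtain vz where
    vz: "r\<^sup>*\<^sup>* (x, e0) (vz, ez)" "ez = {vz, z}" "vz \<noteq> z" "\<forall>s. \<not> r (vz, ez) s" by (elim exE conjE)
  have "r\<^sup>*\<^sup>* (vy, ey) (vz, ez) \<or> r\<^sup>*\<^sup>* (vz, ez) (vy, ey)"
    by (rule rtranclp_functional_linear[OF vy(1) vz(1)]) (rule fn)
  then have "(vy, ey) = (vz, ez)"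
  proof
    assume "r\<^sup>*\<^sup>* (vy, ey) (vz, ez)"
    then show ?thesis by (cases rule: converse_rtranclpE) (use vy(3) in simp_all)
  next
    assume "r\<^sup>*\<^sup>* (vz, ez) (vy, ey)"
    then show ?thesis by (cases rule: converse_rtranclpE) (use vz(4) in simp_all)
  qed
  then have "{vz, y} = {vz, z}" using vy(2) vz(2) by (metis Pair_inject)
  then show ?thesis using vz(3) by (metis doubleton_eq_iff)
qed

definition joined :: "'a set set \<Rightarrow> ('a set \<Rightarrow> nat) \<Rightarrow> nat \<Rightarrow> 'a \<Rightarrow> 'a \<Rightarrow> bool" where
  "joined E f c x y \<longleftrightarrow> {x, y} \<in> E \<and> f {x, y} = c"

lemma joined_sym: "joined E f c x y \<Longrightarrow> joined E f c y x"
  by (simp add: joined_def insert_commute)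

subsection \<open>Colourings with one colour more than the degree\<close>

locale near_regular =
  fixes V :: "'a set" and E :: "'a set set" and C :: "nat set"
  assumes graph: "simple_graph V E"
    and finite_C: "finite C"
    and degree_C: "\<And>x. x \<in> V \<Longrightarrow> Suc (degree E x) = card C"
begin

text \<open>Meaningful on V only, where the missing colour is unique.\<close>
definition miss :: "('a set \<Rightarrow> nat) \<Rightarrow> 'a \<Rightarrow> nat" where
  "miss f x = (THE c. c \<in> C \<and> (\<forall>e\<in>E. x \<in> e \<longrightarrow> f e \<noteq> c))"

abbreviation reach :: "('a set \<Rightarrow> nat) \<Rightarrow> ('a set \<Rightarrow> nat) \<Rightarrow> bool" where
  "reach \<equiv> (kempe_step E C)\<^sup>*\<^sup>*"

lemma edge_pair: "e \<in> E \<Longrightarrow> \<exists>p q. p \<noteq> q \<and> p \<in> V \<and> q \<in> V \<and> e = {p, q}"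
  using graph unfolding simple_graph_def by blast

lemma edge_V: "e \<in> E \<Longrightarrow> x \<in> e \<Longrightarrow> x \<in> V"
  using edge_pair by blast

lemma finite_E: "finite E"
proof (rule finite_subset)
  show "E \<subseteq> Pow V" using edge_pair by blast
  show "finite (Pow V)" using graph unfolding simple_graph_def by simp
qed

lemma edge_inj:
  assumes "coloring E C f" "e \<in> E" "e' \<in> E" "x \<in> e" "x \<in> e'" "f e = f e'"
  shows "e = e'"
  using assms unfolding coloring_def adj_edges_def by blast

lemma edge_other_end: "e \<in> E \<Longrightarrow> x \<in> e \<Longrightarrow> \<exists>y. e = {x, y} \<and> x \<noteq> y"
  using edge_pair by (metis insertE insert_commute singletonD)

lemma joined_V: "joined E f c x y \<Longrightarrow> x \<in> V \<and> y \<in> V \<and> x \<noteq> y"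
  unfolding joined_def using edge_pair by (metis doubleton_eq_iff)

lemma joined_unique:
  assumes "coloring E C f" "joined E f c x y" "joined E f c x y'"
  shows "y = y'"
proof -
  have "{x, y} = {x, y'}"
    using edge_inj[OF assms(1), of "{x, y}" "{x, y'}" x] assms(2,3) unfolding joined_def by simp
  then show ?thesis by (metis doubleton_eq_iff)
qed

lemma miss_unique:
  assumes f: "coloring E C f" and x: "x \<in> V"
  shows "\<exists>!c. c \<in> C \<and> (\<forall>e\<in>E. x \<in> e \<longrightarrow> f e \<noteq> c)"
proof -
  let ?I = "{e \<in> E. x \<in> e}"
  have inj: "inj_on f ?I" using edge_inj[OF f] unfolding inj_on_def by blast
  have sub: "f ` ?I \<subseteq> C" using f unfolding coloring_def by blast
  have "Suc (card (f ` ?I)) = card C"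
    using degree_C[OF x] card_image[OF inj] unfolding degree_def by simp
  moreover have "card (C - f ` ?I) = card C - card (f ` ?I)"
    by (rule card_Diff_subset) (use sub finite_C finite_subset in auto)
  ultimately have "card (C - f ` ?I) = 1" by linarith
  then obtain c where "C - f ` ?I = {c}" by (auto simp: card_1_singleton_iff)
  then show ?thesis by (intro ex1I[of _ c]) blast+
qed

lemma miss_props:
  assumes "coloring E C f" "x \<in> V"
  shows "miss f x \<in> C" "e \<in> E \<Longrightarrow> x \<in> e \<Longrightarrow> f e \<noteq> miss f x"
  using theI'[OF miss_unique[OF assms]] unfolding miss_def by auto

lemma miss_eqI:
  assumes "coloring E C f" "x \<in> V" "c \<in> C" "\<And>e. e \<in> E \<Longrightarrow> x \<in> e \<Longrightarrow> f e \<noteq> c"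
  shows "miss f x = c"
  using miss_unique[OF assms(1,2)] miss_props[OF assms(1,2)] assms(3,4) by blast

lemma not_joined_miss: "coloring E C f \<Longrightarrow> joined E f c x y \<Longrightarrow> miss f x \<noteq> c \<and> c \<in> C"
  using joined_V miss_props(2)[of f x "{x, y}"] unfolding joined_def coloring_def by blast

lemma joined_exists:
  assumes "coloring E C f" "x \<in> V" "c \<in> C" "c \<noteq> miss f x"
  shows "\<exists>y. joined E f c x y"
proof -
  obtain e where "e \<in> E" "x \<in> e" "f e = c"
    using miss_eqI[OF assms(1,2,3)] assms(4) by blast
  then show ?thesis using edge_other_end unfolding joined_def by metis
qed

text \<open>If \<open>S\<close> meets \<open>x\<close>, closedness puts all \<open>a\<close>- and
  \<open>b\<close>-edges at \<open>x\<close> into \<open>S\<close>. The colours at \<open>x\<close>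
  are then permuted as a whole by the swap, and the missing colour with them.\<close>

lemma miss_flip:
  assumes f: "coloring E C f" and S: "kempe_closed E f a b S" and ab: "a \<in> C" "b \<in> C" and x: "x \<in> V"
  shows "miss (flip a b S f) x = (if \<exists>e\<in>S. x \<in> e then swap_col a b (miss f x) else miss f x)"
proof (rule miss_eqI[OF coloring_flip[OF f S ab] x])
  show "(if \<exists>e\<in>S. x \<in> e then swap_col a b (miss f x) else miss f x) \<in> C"
    using miss_props(1)[OF f x] ab by (auto simp: swap_col_def)
next
  fix e assume e: "e \<in> E" "x \<in> e"
  have ne: "f e \<noteq> miss f x" using miss_props(2)[OF f x] e by blast
  have col: "f e' \<in> {a, b}" if "e' \<in> S" for e'
    using S that unfolding kempe_closed_def two_col_edges_def by blast
  have mem: "e \<in> S" if "e' \<in> S" "x \<in> e'" "f e \<in> {a, b}" for e'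
    using S that e unfolding kempe_closed_def two_col_edges_def by blast
  show "flip a b S f e \<noteq> (if \<exists>e\<in>S. x \<in> e then swap_col a b (miss f x) else miss f x)"
    using ne col[of e] mem e(2) unfolding flip_def swap_col_def by (smt (verit) insert_iff singletonD)
qed

text \<open>What remains known about f' after flipping the component of colours a, b that ends at x:
  y is its other end, or arbitrary if there is none.\<close>
definition chained ::
  "('a set \<Rightarrow> nat) \<Rightarrow> nat \<Rightarrow> nat \<Rightarrow> 'a \<Rightarrow> ('a set \<Rightarrow> nat) \<Rightarrow> 'a \<Rightarrow> bool" where
  "chained f a b x f' y \<longleftrightarrow> miss f' x = b \<and>
     (\<forall>z\<in>V. z \<noteq> x \<longrightarrow> z \<noteq> y \<longrightarrow> miss f' z = miss f z) \<and>
     (\<forall>z\<in>V. miss f z \<notin> {a, b} \<longrightarrow> miss f' z = miss f z) \<and>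
     (\<forall>z\<in>V. miss f z \<in> {a, b} \<longrightarrow> miss f' z \<in> {a, b}) \<and>
     (\<forall>e. f e \<notin> {a, b} \<longrightarrow> f' e = f e) \<and>
     (\<forall>e. f e \<in> {a, b} \<longrightarrow> f' e \<in> {a, b}) \<and>
     (\<forall>z w c. joined E f c z w \<longrightarrow> miss f z \<in> {a, b} \<longrightarrow> miss f' z = miss f z \<longrightarrow> joined E f' c z w)"

lemma chainedD:
  assumes "chained f a b x f' y"
  shows "miss f' x = b"
    "z \<in> V \<Longrightarrow> z \<noteq> x \<Longrightarrow> z \<noteq> y \<Longrightarrow> miss f' z = miss f z"
    "z \<in> V \<Longrightarrow> miss f z \<notin> {a, b} \<Longrightarrow> miss f' z = miss f z"
    "z \<in> V \<Longrightarrow> miss f z \<in> {a, b} \<Longrightarrow> miss f' z \<in> {a, b}"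
    "f e \<notin> {a, b} \<Longrightarrow> f' e = f e"
    "f e \<in> {a, b} \<Longrightarrow> f' e \<in> {a, b}"
    "joined E f c z w \<Longrightarrow> miss f z \<in> {a, b} \<Longrightarrow> miss f' z = miss f z \<Longrightarrow> joined E f' c z w"
    "joined E f c z w \<Longrightarrow> c \<notin> {a, b} \<Longrightarrow> joined E f' c z w"
proof -
  note c = assms[unfolded chained_def]
  note c1 = c[THEN conjunct2] note c2 = c1[THEN conjunct2] note c3 = c2[THEN conjunct2]
  note c4 = c3[THEN conjunct2] note c5 = c4[THEN conjunct2] note c6 = c5[THEN conjunct2]
  show "miss f' x = b" by (rule c[THEN conjunct1])
  show "z \<in> V \<Longrightarrow> z \<noteq> x \<Longrightarrow> z \<noteq> y \<Longrightarrow> miss f' z = miss f z" using c1[THEN conjunct1] by blast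
  show "z \<in> V \<Longrightarrow> miss f z \<notin> {a, b} \<Longrightarrow> miss f' z = miss f z" using c2[THEN conjunct1] by blast
  show "z \<in> V \<Longrightarrow> miss f z \<in> {a, b} \<Longrightarrow> miss f' z \<in> {a, b}" using c3[THEN conjunct1] by blast
  show e: "f e \<notin> {a, b} \<Longrightarrow> f' e = f e" for e using c4[THEN conjunct1] by blast
  show "f e \<in> {a, b} \<Longrightarrow> f' e \<in> {a, b}" using c5[THEN conjunct1] by blast
  show "joined E f c z w \<Longrightarrow> miss f z \<in> {a, b} \<Longrightarrow> miss f' z = miss f z \<Longrightarrow> joined E f' c z w"
    using c6 by blast
  show "joined E f c z w \<Longrightarrow> c \<notin> {a, b} \<Longrightarrow> joined E f' c z w"
    using e[of "{z, w}"] unfolding joined_def by simp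
qed

text \<open>Protects two vertices from a flip that starts elsewhere. At most one of
  \<open>p\<close>, \<open>q\<close> is the other end of the chain, so one of them keeps its colour;
  both colours stay in \<open>{a, b}\<close> and differ, so the other is unchanged as well. The
  inequality for \<open>f'\<close> usually comes from an earlier exclusion applied to
  \<open>f'\<close>.\<close>

lemma chained_two:
  assumes c: "chained f a b x f' y" and "p \<in> V" "q \<in> V" "p \<noteq> x" "q \<noteq> x" "p \<noteq> q"
    and "miss f p \<in> {a, b}" "miss f q \<in> {a, b}" "miss f p \<noteq> miss f q" "miss f' p \<noteq> miss f' q"
  shows "miss f' p = miss f p" "miss f' q = miss f q"
proof -
  have "miss f' p = miss f p \<or> miss f' q = miss f q"
    using chainedD(2)[OF c assms(2)] chainedD(2)[OF c assms(3)] assms(4-6) by metis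
  moreover have "miss f' p \<in> {a, b}" "miss f' q \<in> {a, b}"
    using chainedD(4)[OF c] assms(2,3,7,8) by blast+
  ultimately show "miss f' p = miss f p" "miss f' q = miss f q"
    using assms(7-10) by (metis insertE singletonD)+
qed

lemma chain_flip:
  assumes f: "coloring E C f" and ab: "a \<noteq> b" "a \<in> C" "b \<in> C" and x: "x \<in> V" "miss f x = a"
  obtains f' y where "reach f f'" "chained f a b x f' y"
proof -
  let ?H = "two_col_edges E f a b"
  have "b \<noteq> miss f x" using ab x by simp
  then obtain w where "joined E f b x w" using joined_exists[OF f x(1) ab(3)] by blast
  then have e0: "{x, w} \<in> ?H" unfolding joined_def two_col_edges_def by simp
  define K where "K = kempe_component E f a b {x, w}"
  have Kc: "kempe_closed E f a b K" unfolding K_def by (rule kempe_closed_component)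
  have e0K: "{x, w} \<in> K" unfolding K_def by (rule kempe_component_refl[OF e0])
  have KE: "K \<subseteq> ?H" using Kc unfolding kempe_closed_def by blast
  define f' where "f' = flip a b K f"
  have mf: "miss f' z = (if \<exists>e\<in>K. z \<in> e then swap_col a b (miss f z) else miss f z)" if "z \<in> V" for z
    unfolding f'_def by (rule miss_flip[OF f Kc ab(2,3) that])
  have at_end: "e = e'" if "v \<in> V" "miss f v \<in> {a, b}" "e \<in> ?H" "e' \<in> ?H" "v \<in> e" "v \<in> e'" for v e e'
  proof -
    have "f e \<noteq> miss f v" "f e' \<noteq> miss f v" "e \<in> E" "e' \<in> E"
      using miss_props(2)[OF f that(1)] that unfolding two_col_edges_def by auto
    then have "f e = f e'" using that unfolding two_col_edges_def by auto
    then show ?thesis using edge_inj[OF f \<open>e \<in> E\<close> \<open>e' \<in> E\<close>] that by blast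
  qed
  \<comment> \<open>A vertex missing \<open>a\<close> or \<open>b\<close> meets at most one edge
    coloured \<open>a\<close> or \<open>b\<close>, so it can only be an end of \<open>K\<close>;
    besides \<open>x\<close> there is at most one.\<close>
  have two: "y = z" if yz: "y \<in> V" "z \<in> V" "y \<noteq> x" "z \<noteq> x" "miss f y \<in> {a, b}" "miss f z \<in> {a, b}"
      "ey \<in> K" "y \<in> ey" "ez \<in> K" "z \<in> ez" for y z ey ez
  proof (rule kempe_component_ends[where E = E and f = f and a = a and b = b and x = x and ?e0.0 = "{x, w}"
        and y = y and z = z and ey = ey and ez = ez])
    show "\<exists>p q. p \<noteq> q \<and> e = {p, q}" if "e \<in> E" for e using edge_pair[OF that] by blast
    show "e1 = e2 \<or> e1 = e3 \<or> e2 = e3"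
      if "e1 \<in> ?H" "e2 \<in> ?H" "e3 \<in> ?H" "v \<in> e1" "v \<in> e2" "v \<in> e3" for v e1 e2 e3
      using that edge_inj[OF f] unfolding two_col_edges_def by (smt (verit) mem_Collect_eq)
    show "e = e'" if "v \<in> {x, y, z}" "e \<in> ?H" "e' \<in> ?H" "v \<in> e" "v \<in> e'" for e e' v
      using at_end[of v e e'] that yz x by auto
    show "{x, w} \<in> ?H" by (fact e0)
  qed (use yz(3,4,7-10) in \<open>simp_all add: K_def\<close>)
  define Q where "Q y \<longleftrightarrow> y \<in> V \<and> y \<noteq> x \<and> miss f y \<in> {a, b} \<and> (\<exists>e\<in>K. y \<in> e)" for y
  define y where "y = (SOME y. Q y)"
  show thesis
  proof (rule that[of f' y], goal_cases)
    case 1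
    have "finite K" using KE finite_E unfolding two_col_edges_def by (simp add: finite_subset)
    then show ?case unfolding f'_def using kempe_closed_reachable[OF _ Kc ab(2,3)] by blast
  next
    case 2
    have "miss f' x = b" using mf[OF x(1)] e0K x(2) by (auto simp: swap_col_def)
    moreover have "miss f' z = miss f z" if z: "z \<in> V" "z \<noteq> x" "z \<noteq> y" for z
    proof (rule ccontr)
      assume "miss f' z \<noteq> miss f z"
      then obtain ez where ez: "ez \<in> K" "z \<in> ez" "miss f z \<in> {a, b}"
        using mf[OF z(1)] by (auto simp: swap_col_def split: if_splits)
      then have "Q z" unfolding Q_def using z(1,2) by blast
      then have "Q y" unfolding y_def by (rule someI)
      then obtain ey where "y \<in> V" "y \<noteq> x" "miss f y \<in> {a, b}" "ey \<in> K" "y \<in> ey"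
        unfolding Q_def by blast
      then show False using two[of y z ey ez] z ez by simp
    qed
    moreover have "miss f' z = miss f z" if "z \<in> V" "miss f z \<notin> {a, b}" for z
      using mf[OF that(1)] that by (auto simp: swap_col_def)
    moreover have "miss f' z \<in> {a, b}" if "z \<in> V" "miss f z \<in> {a, b}" for z
      using mf[OF that(1)] that by (auto simp: swap_col_def)
    moreover have "f' e = f e" if "f e \<notin> {a, b}" for e
      using that KE unfolding f'_def flip_def two_col_edges_def by auto
    moreover have "f' e \<in> {a, b}" if "f e \<in> {a, b}" for e
      using that unfolding f'_def flip_def swap_col_def by auto
    \<comment> \<open>If \<open>K\<close> met \<open>z\<close>, the missing colour of
      \<open>z\<close> would have been swapped. Hence \<open>K\<close> avoids \<open>z\<close>, and
      even its edges coloured \<open>a\<close> or \<open>b\<close> are kept.\<close>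
    moreover have "joined E f' c z w" if "joined E f c z w" "miss f z \<in> {a, b}" "miss f' z = miss f z" for z w c
    proof -
      have "z \<in> V" using joined_V that(1) by blast
      then have "\<not> (\<exists>e\<in>K. z \<in> e)" using mf that ab(1) by (auto simp: swap_col_def split: if_splits)
      then show ?thesis using that(1) unfolding joined_def f'_def flip_def by auto
    qed
    ultimately show ?case unfolding chained_def by blast
  qed
qed

section \<open>Flips of explicit short paths\<close>

text \<open>A test at each vertex: when each of \<open>a\<close>, \<open>b\<close> is either missing
  there or already used by an edge of \<open>S\<close>, no further edge can extend
  \<open>S\<close>.\<close>

lemma kempe_closedI:
  assumes f: "coloring E C f" and ab: "a \<in> C" "b \<in> C"
    and S: "S \<subseteq> E" "\<And>e. e \<in> S \<Longrightarrow> f e \<in> {a, b}"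
    and cl: "\<And>x. x \<in> \<Union>S \<Longrightarrow> (miss f x = b \<or> (\<exists>e\<in>S. x \<in> e \<and> f e = b)) \<and> (miss f x = a \<or> (\<exists>e\<in>S. x \<in> e \<and> f e = a))"
  shows "kempe_closed E f a b S"
  unfolding kempe_closed_def
proof (intro conjI ballI impI)
  show "S \<subseteq> two_col_edges E f a b" using S unfolding two_col_edges_def by blast
  fix e e' assume *: "e \<in> S" "e' \<in> two_col_edges E f a b" "e \<inter> e' \<noteq> {}"
  then obtain x where x: "x \<in> e" "x \<in> e'" by blast
  have e': "e' \<in> E" "f e' \<in> {a, b}" using * unfolding two_col_edges_def by auto
  then have "f e' \<noteq> miss f x" using miss_props(2)[OF f _ e'(1) x(2)] edge_pair x(2) by blast
  moreover have "x \<in> \<Union>S" using *(1) x(1) by blast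
  ultimately obtain e1 where "e1 \<in> S" "x \<in> e1" "f e1 = f e'"
    using cl[of x] e'(2) by auto
  then show "e' \<in> S" using edge_inj[OF f _ e'(1) _ x(2)] S(1) by blast
qed

text \<open>Since \<open>b\<close> is missing at both ends, the edge alone is a component of the
  \<open>a\<close>, \<open>b\<close> subgraph.\<close>

lemma recolor_edge:
  assumes f: "coloring E C f" and "joined E f a x y" "miss f x = b" "miss f y = b"
  defines "f' \<equiv> f({x, y} := b)"
  shows "reach f f'" "miss f' x = a" "miss f' y = a"
    "\<And>z. z \<in> V \<Longrightarrow> z \<noteq> x \<Longrightarrow> z \<noteq> y \<Longrightarrow> miss f' z = miss f z"
proof -
  have V: "x \<in> V" "y \<in> V" and a: "a \<in> C" and b: "b \<in> C" and e: "{x, y} \<in> E" "f {x, y} = a"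
    using assms joined_V not_joined_miss[OF f] miss_props(1)[OF f] unfolding joined_def by blast+
  have S: "kempe_closed E f a b {{x, y}}"
    by (rule kempe_closedI[OF f a b]) (use e assms in auto)
  have eq: "f' = flip a b {{x, y}} f"
    unfolding f'_def flip_def fun_eq_iff using e by (auto simp: swap_col_def)
  show "reach f f'" unfolding eq by (rule kempe_closed_reachable[OF _ S a b]) simp
  show "miss f' x = a" "miss f' y = a"
    unfolding eq using miss_flip[OF f S a b] V assms by (auto simp: swap_col_def)
  show "miss f' z = miss f z" if "z \<in> V" "z \<noteq> x" "z \<noteq> y" for z
    unfolding eq using miss_flip[OF f S a b] that by simp
qed

text \<open>The alternating path is a full component, because each end misses the colour that would
  continue it. The result is written with explicit updates so that the colour of each named edge can
  be read off; \<open>flip_path3\<close> and \<open>flip_path4\<close> treat longer paths in the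
  same way.\<close>

lemma flip_path2:
  assumes f: "coloring E C f" and "joined E f a x y" "joined E f b y z" "miss f x = b" "miss f z = a"
  defines "f' \<equiv> f({x, y} := b, {y, z} := a)"
  shows "reach f f'" "miss f' x = a" "miss f' z = b"
    "\<And>w. w \<in> V \<Longrightarrow> w \<noteq> x \<Longrightarrow> w \<noteq> z \<Longrightarrow> miss f' w = miss f w"
proof -
  let ?S = "{{y, z}, {x, y}}"
  have V: "x \<in> V" "y \<in> V" "z \<in> V" and a: "a \<in> C" and b: "b \<in> C"
    and e: "{x, y} \<in> E" "f {x, y} = a" "{y, z} \<in> E" "f {y, z} = b"
    using assms joined_V not_joined_miss[OF f] miss_props(1)[OF f] unfolding joined_def by blast+
  have ne: "a \<noteq> b" using not_joined_miss[OF f assms(2)] assms(4) by auto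
  have y: "miss f y \<noteq> a" "miss f y \<noteq> b"
    using not_joined_miss[OF f joined_sym[OF assms(2)]] not_joined_miss[OF f assms(3)] by auto
  have S: "kempe_closed E f a b ?S"
    by (rule kempe_closedI[OF f a b]) (use e assms in auto)
  have eq: "f' = flip a b ?S f"
    unfolding f'_def by (simp add: flip_insert flip_empty e ne ne[symmetric] swap_col_def)
  show "reach f f'" unfolding eq by (rule kempe_closed_reachable[OF _ S a b]) simp
  show "miss f' x = a" "miss f' z = b"
    unfolding eq using miss_flip[OF f S a b] V assms by (auto simp: swap_col_def)
  show "miss f' w = miss f w" if "w \<in> V" "w \<noteq> x" "w \<noteq> z" for w
    unfolding eq using miss_flip[OF f S a b] that y by (auto simp: swap_col_def)
qed

lemma flip_path3:
  assumes f: "coloring E C f"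
    and "joined E f a x y" "joined E f b y z" "joined E f a z w" "miss f x = b" "miss f w = b"
  defines "f' \<equiv> f({x, y} := b, {y, z} := a, {z, w} := b)"
  shows "reach f f'" "miss f' x = a" "miss f' w = a"
    "\<And>t. t \<in> V \<Longrightarrow> t \<noteq> x \<Longrightarrow> t \<noteq> w \<Longrightarrow> miss f' t = miss f t"
proof -
  let ?S = "{{z, w}, {y, z}, {x, y}}"
  have V: "x \<in> V" "y \<in> V" "z \<in> V" "w \<in> V" and a: "a \<in> C" and b: "b \<in> C"
    and e: "{x, y} \<in> E" "f {x, y} = a" "{y, z} \<in> E" "f {y, z} = b" "{z, w} \<in> E" "f {z, w} = a"
    using assms joined_V not_joined_miss[OF f] miss_props(1)[OF f] unfolding joined_def by blast+
  have ne: "a \<noteq> b" using not_joined_miss[OF f assms(2)] assms(5) by auto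
  \<comment> \<open>Inner vertices of the path carry both colours, so the swap does not touch what
    they miss.\<close>
  have y: "miss f y \<noteq> a" "miss f y \<noteq> b" "miss f z \<noteq> a" "miss f z \<noteq> b"
    using not_joined_miss[OF f joined_sym[OF assms(2)]] not_joined_miss[OF f assms(3)]
      not_joined_miss[OF f joined_sym[OF assms(3)]] not_joined_miss[OF f assms(4)] by auto
  have S: "kempe_closed E f a b ?S"
    by (rule kempe_closedI[OF f a b]) (use e assms in auto)
  have eq: "f' = flip a b ?S f"
    unfolding f'_def by (simp add: flip_insert flip_empty e ne ne[symmetric] swap_col_def)
  show "reach f f'" unfolding eq by (rule kempe_closed_reachable[OF _ S a b]) simp
  show "miss f' x = a" "miss f' w = a"
    unfolding eq using miss_flip[OF f S a b] V assms by (auto simp: swap_col_def)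
  show "miss f' t = miss f t" if "t \<in> V" "t \<noteq> x" "t \<noteq> w" for t
    unfolding eq using miss_flip[OF f S a b] that y by (auto simp: swap_col_def)
qed

lemma flip_path4:
  assumes f: "coloring E C f"
    and "joined E f a x y" "joined E f b y z" "joined E f a z w" "joined E f b w t"
    and "miss f x = b" "miss f t = a"
  defines "f' \<equiv> f({x, y} := b, {y, z} := a, {z, w} := b, {w, t} := a)"
  shows "reach f f'" "miss f' x = a" "miss f' t = b"
    "\<And>s. s \<in> V \<Longrightarrow> s \<noteq> x \<Longrightarrow> s \<noteq> t \<Longrightarrow> miss f' s = miss f s"
proof -
  let ?S = "{{w, t}, {z, w}, {y, z}, {x, y}}"
  have V: "x \<in> V" "y \<in> V" "z \<in> V" "w \<in> V" "t \<in> V" and a: "a \<in> C" and b: "b \<in> C"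
    and e: "{x, y} \<in> E" "f {x, y} = a" "{y, z} \<in> E" "f {y, z} = b" "{z, w} \<in> E" "f {z, w} = a"
      "{w, t} \<in> E" "f {w, t} = b"
    using assms joined_V not_joined_miss[OF f] miss_props(1)[OF f] unfolding joined_def by blast+
  have ne: "a \<noteq> b" using not_joined_miss[OF f assms(2)] assms(6) by auto
  have y: "miss f y \<noteq> a" "miss f y \<noteq> b" "miss f z \<noteq> a" "miss f z \<noteq> b" "miss f w \<noteq> a" "miss f w \<noteq> b"
    using not_joined_miss[OF f joined_sym[OF assms(2)]] not_joined_miss[OF f assms(3)]
      not_joined_miss[OF f joined_sym[OF assms(3)]] not_joined_miss[OF f assms(4)]
      not_joined_miss[OF f joined_sym[OF assms(4)]] not_joined_miss[OF f assms(5)] by auto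
  have S: "kempe_closed E f a b ?S"
    by (rule kempe_closedI[OF f a b]) (use e assms in auto)
  have eq: "f' = flip a b ?S f"
    unfolding f'_def by (simp add: flip_insert flip_empty e ne ne[symmetric] swap_col_def)
  show "reach f f'" unfolding eq by (rule kempe_closed_reachable[OF _ S a b]) simp
  show "miss f' x = a" "miss f' t = b"
    unfolding eq using miss_flip[OF f S a b] V assms by (auto simp: swap_col_def)
  show "miss f' s = miss f s" if "s \<in> V" "s \<noteq> x" "s \<noteq> t" for s
    unfolding eq using miss_flip[OF f S a b] that y by (auto simp: swap_col_def)
qed

end

lemma joined_upd_other:
  "joined E f c x y \<Longrightarrow> e \<noteq> {x, y} \<Longrightarrow> joined E (f(e := c')) c x y"
  unfolding joined_def by simp

subsection \<open>Vertices missing the colour of a perfect matching\<close>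

locale near_regular_matching = near_regular V E C for V :: "'a set" and E C +
  fixes M :: "'a set set" and j :: nat
  assumes card_C: "card C \<le> 5" and j_C: "j \<in> C" and M_E: "M \<subseteq> E"
    and M_perfect: "\<And>x. x \<in> V \<Longrightarrow> \<exists>!e. e \<in> M \<and> x \<in> e"
begin

section \<open>Optimal colourings and defects\<close>

definition good :: "('a set \<Rightarrow> nat) \<Rightarrow> 'a set set" where
  "good f = {e \<in> M. f e = j}"

definition opt :: "('a set \<Rightarrow> nat) \<Rightarrow> bool" where
  "opt f \<longleftrightarrow> coloring E C f \<and> (\<forall>f'. reach f f' \<longrightarrow> card (good f') \<le> card (good f))"

text \<open>The edge \<open>{u, v}\<close> should have colour \<open>j\<close>, but
  \<open>{v, w}\<close> blocks this at \<open>v\<close>. In the letters of the overview,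
  \<open>a = f {u, v}\<close>, \<open>b = miss f w\<close>, \<open>d = miss f v\<close>, and
  \<open>c = miss f s\<close> once \<open>s\<close> is introduced.\<close>

definition defect :: "('a set \<Rightarrow> nat) \<Rightarrow> 'a \<Rightarrow> 'a \<Rightarrow> 'a \<Rightarrow> bool" where
  "defect f u v w \<longleftrightarrow> opt f \<and> u \<in> V \<and> miss f u = j \<and> {u, v} \<in> M \<and> joined E f j v w"

lemma M_unique: "{x, y} \<in> M \<Longrightarrow> {x, z} \<in> M \<Longrightarrow> y = z"
proof -
  assume *: "{x, y} \<in> M" "{x, z} \<in> M"
  then have "x \<in> V" using M_E edge_V[of "{x, y}"] by blast
  then have "{x, y} = {x, z}" using M_perfect * by blast
  then show ?thesis by (metis doubleton_eq_iff)
qed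

lemma finite_good: "finite (good f)"
  unfolding good_def by (rule finite_subset[OF _ finite_E]) (use M_E in blast)

text \<open>The maximum is taken over everything reachable, and whatever is reachable from
  \<open>f'\<close> is reachable from \<open>f\<close>.\<close>

lemma opt_transfer:
  assumes "opt f" "reach f f'" "card (good f) \<le> card (good f')"
  shows "opt f'"
  using assms kempe_reachable_coloring unfolding opt_def by (meson le_trans rtranclp_trans)

lemma opt_same:
  assumes "opt f" "reach f f'" "\<And>e. e \<in> M \<Longrightarrow> f' e = j \<longleftrightarrow> f e = j"
  shows "opt f'"
proof -
  have "good f' = good f" unfolding good_def using assms(3) by blast
  then show ?thesis using opt_transfer assms(1,2) by simp
qed

text \<open>The standard way to a contradiction: Kempe changes that keep \<open>j\<close> on all
  good matching edges and add it to one more.\<close>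

lemma opt_gain:
  assumes "opt f" "reach f f'" "e0 \<in> M" "f e0 \<noteq> j" "f' e0 = j"
    and "\<And>e. e \<in> M \<Longrightarrow> f e = j \<Longrightarrow> f' e = j"
  shows False
proof -
  have "good f \<subset> good f'" unfolding good_def using assms(3-) by blast
  then have "card (good f) < card (good f')" by (rule psubset_card_mono[OF finite_good])
  then show False using assms(1,2) unfolding opt_def by (meson leD)
qed

text \<open>With fewer than five colours the assumptions are contradictory, so this one equality
  serves every degree met in the induction.\<close>

lemma five_colors:
  assumes "{c1, c2, c3, c4, c5} \<subseteq> C" "distinct [c1, c2, c3, c4, c5]"
  shows "C = {c1, c2, c3, c4, c5}"
proof -
  have "card {c1, c2, c3, c4, c5} = 5" using assms(2) by simp
  then show ?thesis using card_seteq[OF finite_C assms(1)] card_C by simp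
qed

lemma defectD:
  assumes "defect f u v w"
  shows "coloring E C f" "opt f" "u \<in> V" "v \<in> V" "w \<in> V" "u \<noteq> v" "v \<noteq> w" "u \<noteq> w"
    "miss f u = j" "miss f v \<noteq> j" "miss f w \<noteq> j" "{u, v} \<in> M" "{v, w} \<notin> M"
    "joined E f j v w" "joined E f j w v" "joined E f (f {u, v}) u v" "f {u, v} \<noteq> j"
    "miss f v \<noteq> f {u, v}" "f {u, v} \<in> C" "miss f v \<in> C" "miss f w \<in> C"
proof -
  show c: "coloring E C f" and o: "opt f" and u: "u \<in> V" "miss f u = j" and M: "{u, v} \<in> M"
    and vw: "joined E f j v w"
    using assms unfolding defect_def opt_def by auto
  show wv: "joined E f j w v" by (rule joined_sym[OF vw])
  show V: "v \<in> V" "w \<in> V" "v \<noteq> w" using joined_V[OF vw] by auto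
  show uv: "joined E f (f {u, v}) u v" using M M_E unfolding joined_def by blast
  show "u \<noteq> v" using joined_V[OF uv] by blast
  show m: "miss f v \<noteq> j" "miss f w \<noteq> j" using not_joined_miss[OF c] vw wv by blast+
  show "u \<noteq> w" using m u by blast
  then show "{v, w} \<notin> M" using M M_unique[of v u w] by (metis insert_commute)
  show "f {u, v} \<noteq> j" "f {u, v} \<in> C" using not_joined_miss[OF c uv] u by auto
  show "miss f v \<noteq> f {u, v}" using not_joined_miss[OF c joined_sym[OF uv]] by auto
  show "miss f v \<in> C" "miss f w \<in> C" using miss_props(1)[OF c] V by auto
qed

text \<open>Changes that avoid \<open>j\<close> preserve the configuration, so each exclusion proved
  below for a defect may be applied again after such a change.\<close>

lemma defect_transfer:
  assumes d: "defect f u v w" and r: "reach f f'" and j: "\<And>e. f' e = j \<longleftrightarrow> f e = j"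
  shows "defect f' u v w"
proof -
  note D = defectD[OF d]
  have c: "coloring E C f'" using kempe_reachable_coloring[OF r] D(1) .
  have "miss f' u = j"
    by (rule miss_eqI[OF c D(3) j_C]) (use miss_props(2)[OF D(1,3)] D(9) j in metis)
  moreover have "opt f'" by (rule opt_same[OF D(2) r]) (use j in blast)
  ultimately show ?thesis
    using D j unfolding defect_def joined_def by blast
qed

lemma defect_recolor:
  assumes d: "defect f u v w" and xy: "joined E f a x y" "miss f x = b" "miss f y = b"
    and j: "a \<noteq> j" "b \<noteq> j"
  shows "defect (f({x, y} := b)) u v w"
proof (rule defect_transfer[OF d])
  show "reach f (f({x, y} := b))" by (rule recolor_edge(1)[OF defectD(1)[OF d] xy])
  show "(f({x, y} := b)) e = j \<longleftrightarrow> f e = j" for e using xy(1) j unfolding joined_def by auto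
qed

lemma defect_chain:
  assumes d: "defect f u v w" and ab: "a \<noteq> b" "a \<in> C" "b \<in> C" "a \<noteq> j" "b \<noteq> j"
    and x: "x \<in> V" "miss f x = a"
  obtains f' y where "defect f' u v w" "chained f a b x f' y"
proof -
  obtain f' y where *: "reach f f'" "chained f a b x f' y"
    by (rule chain_flip[OF defectD(1)[OF d] ab(1-3) x])
  have "defect f' u v w"
  proof (rule defect_transfer[OF d *(1)])
    show "f' e = j \<longleftrightarrow> f e = j" for e
      using chainedD(5,6)[OF *(2), of e] ab(4,5) by (cases "f e \<in> {a, b}") auto
  qed
  then show thesis using that *(2) by blast
qed

text \<open>Otherwise \<open>vw\<close> could take the common missing colour. Then \<open>u\<close>
  and \<open>v\<close> both miss \<open>j\<close>, and recolouring \<open>uv\<close> gains a good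
  edge, while \<open>vw\<close> lies outside \<open>M\<close>.\<close>

lemma defect_miss_vw:
  assumes d: "defect f u v w"
  shows "miss f w \<noteq> miss f v"
proof
  assume eq: "miss f w = miss f v"
  note D = defectD[OF d]
  define f1 where "f1 = f({v, w} := miss f v)"
  note r1 = recolor_edge[OF D(1) D(14) refl eq, folded f1_def]
  have c1: "coloring E C f1" using kempe_reachable_coloring[OF r1(1) D(1)] .
  have uv: "joined E f1 (f {u, v}) u v"
    unfolding f1_def by (rule joined_upd_other[OF D(16)]) (use D in \<open>auto simp: doubleton_eq_iff\<close>)
  have u: "miss f1 u = j" using r1(4)[OF D(3)] D by auto
  note r2 = recolor_edge[OF c1 uv u r1(2)]
  show False
    by (rule opt_gain[OF D(2) rtranclp_trans[OF r1(1) r2(1)] D(12)])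
      (use D(13,17) in \<open>auto simp: f1_def\<close>)
qed

text \<open>Otherwise \<open>u\<close>, \<open>v\<close>, \<open>w\<close> form a whole component in
  the colours \<open>a\<close> and \<open>j\<close>; flipping it puts \<open>j\<close> on
  \<open>uv\<close>.\<close>

lemma defect_miss_w:
  assumes d: "defect f u v w"
  shows "miss f w \<noteq> f {u, v}"
proof
  assume eq: "miss f w = f {u, v}"
  note D = defectD[OF d]
  show False
    by (rule opt_gain[OF D(2) flip_path2(1)[OF D(1) D(16) D(14) D(9) eq] D(12)])
      (use D in \<open>auto simp: doubleton_eq_iff\<close>)
qed

section \<open>The neighbours of \<open>w\<close> along \<open>a\<close> and
  \<open>c\<close>\<close>

lemma defect_s_distinct:
  assumes d: "defect f u v w" and s: "joined E f (f {u, v}) w s"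
  shows "s \<in> V" "s \<noteq> u" "s \<noteq> v" "s \<noteq> w" "miss f s \<noteq> f {u, v}"
proof -
  note D = defectD[OF d]
  show "s \<in> V" "s \<noteq> w" using joined_V[OF s] by auto
  show "s \<noteq> v"
    using s D(15,17) unfolding joined_def by auto
  show "s \<noteq> u"
    using joined_unique[OF D(1) D(16)] joined_sym[OF s] D(7) by blast
  show "miss f s \<noteq> f {u, v}" using not_joined_miss[OF D(1) joined_sym[OF s]] by blast
qed

text \<open>If \<open>s\<close> misses \<open>j\<close>, flipping the path \<open>u\<close>,
  \<open>v\<close>, \<open>w\<close>, \<open>s\<close> gains \<open>uv\<close>. If it misses
  \<open>b\<close>, recolouring \<open>ws\<close> makes \<open>w\<close> miss \<open>a\<close>,
  which \<open>defect_miss_w\<close> excludes. If it misses \<open>d\<close>, a chain flip at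
  \<open>s\<close> turns \<open>d\<close> into \<open>b\<close> and leads back to the second
  case.\<close>

lemma defect_miss_s:
  assumes d: "defect f u v w" and s: "joined E f (f {u, v}) w s"
  shows "miss f s \<noteq> j" "miss f s \<noteq> miss f w" "miss f s \<noteq> miss f v"
proof -
  show "miss f s \<noteq> j"
  proof
    note D = defectD[OF d]
    note S = defect_s_distinct[OF d s]
    assume eq: "miss f s = j"
    show False
      by (rule opt_gain[OF D(2) flip_path3(1)[OF D(1) D(16) D(14) s D(9) eq] D(12)])
        (use D S in \<open>auto simp: doubleton_eq_iff\<close>)
  qed
  have sw: False if d: "defect f u v w" and s: "joined E f (f {u, v}) w s" and eq: "miss f s = miss f w" for f
  proof -
    note D = defectD[OF d]
    note S = defect_s_distinct[OF d s]
    let ?f = "f({w, s} := miss f w)"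
    have "defect ?f u v w"
      by (rule defect_recolor[OF d s refl eq]) (use D in auto)
    moreover have "miss ?f w = f {u, v}" by (rule recolor_edge(2)[OF D(1) s refl eq])
    moreover have "?f {u, v} = f {u, v}" using D by (auto simp: doubleton_eq_iff)
    ultimately show False using defect_miss_w by metis
  qed
  show "miss f s \<noteq> miss f w" using sw[OF d s] by blast
  show "miss f s \<noteq> miss f v"
  proof
    assume eq: "miss f s = miss f v"
    note D = defectD[OF d]
    note S = defect_s_distinct[OF d s]
    obtain f' y where d': "defect f' u v w" and ch: "chained f (miss f v) (miss f w) s f' y"
      by (rule defect_chain[OF d defect_miss_vw[OF d, symmetric] D(20,21) D(10,11) S(1) eq])
    \<comment> \<open>\<open>f'\<close> has the same defect, so \<open>v\<close> and
      \<open>w\<close> still miss different colours; by \<open>chained_two\<close> neither was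
      touched.\<close>
    have "miss f' w = miss f w"
      by (rule chained_two(1)[OF ch D(5,4)]) (use S D(7) defect_miss_vw[OF d] defect_miss_vw[OF d'] in auto)
    moreover have "f' {u, v} = f {u, v}" using chainedD(5)[OF ch] D(18) defect_miss_w[OF d] by auto
    moreover have "joined E f' (f {u, v}) w s" using chainedD(8)[OF ch s] D(18) defect_miss_w[OF d] by auto
    ultimately show False using sw[OF d'] chainedD(1)[OF ch] by simp
  qed
qed

lemma defect_colors:
  assumes d: "defect f u v w" and s: "joined E f (f {u, v}) w s"
  shows "C = {j, f {u, v}, miss f v, miss f w, miss f s}"
    "distinct [j, f {u, v}, miss f v, miss f w, miss f s]" "miss f s \<in> C"
proof -
  note D = defectD[OF d]
  note S = defect_s_distinct[OF d s]
  show dist: "distinct [j, f {u, v}, miss f v, miss f w, miss f s]"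
    using D(10,11,17,18) S(5) defect_miss_vw[OF d] defect_miss_w[OF d] defect_miss_s[OF d s] by auto
  show sC: "miss f s \<in> C" by (rule miss_props(1)[OF D(1) S(1)])
  show "C = {j, f {u, v}, miss f v, miss f w, miss f s}"
    by (rule five_colors[OF _ dist]) (use D(19-21) sC j_C in simp)
qed

lemma defect_s_exists:
  assumes d: "defect f u v w"
  obtains s where "joined E f (f {u, v}) w s"
  using joined_exists[OF defectD(1,5,19)[OF d]] defect_miss_w[OF d] by metis

text \<open>If \<open>z\<close> misses \<open>b\<close>, recolouring \<open>wz\<close> makes
  \<open>w\<close> miss \<open>c\<close>, the colour missing at \<open>s\<close>, against
  \<open>defect_miss_s\<close>. If \<open>z\<close> misses \<open>d\<close>, a chain flip at
  \<open>z\<close> turns \<open>d\<close> into \<open>b\<close> without affecting \<open>v\<close>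
  and \<open>w\<close>.\<close>

lemma defect_miss_z:
  assumes d: "defect f u v w" and s: "joined E f (f {u, v}) w s" and z: "joined E f (miss f s) w z"
  shows "miss f z \<noteq> miss f w" "miss f z \<noteq> miss f v"
proof -
  have zw: False if d: "defect f u v w" and s: "joined E f (f {u, v}) w s"
    and z: "joined E f (miss f s) w z" and eq: "miss f z = miss f w" for f
  proof -
    note D = defectD[OF d]
    note S = defect_s_distinct[OF d s]
    note X = defect_colors(2)[OF d s]
    let ?f = "f({w, z} := miss f w)"
    have zs: "z \<noteq> s" using s z X unfolding joined_def by auto
    have d': "defect ?f u v w"
      by (rule defect_recolor[OF d z refl eq]) (use X in auto)
    have mw: "miss ?f w = miss f s" by (rule recolor_edge(2)[OF D(1) z refl eq])
    have ms: "miss ?f s = miss f s"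
      by (rule recolor_edge(4)[OF D(1) z refl eq S(1)]) (use S zs in auto)
    have "?f {u, v} = f {u, v}" using D by (auto simp: doubleton_eq_iff)
    moreover have "joined E ?f (f {u, v}) w s"
      by (rule joined_upd_other[OF s]) (use zs in \<open>auto simp: doubleton_eq_iff\<close>)
    ultimately show False using defect_miss_s(2)[OF d', of s] mw ms by simp
  qed
  show "miss f z \<noteq> miss f w" using zw[OF d s z] by blast
  show "miss f z \<noteq> miss f v"
  proof
    assume eq: "miss f z = miss f v"
    note D = defectD[OF d]
    note S = defect_s_distinct[OF d s]
    note X = defect_colors(2)[OF d s]
    have zV: "z \<in> V" "z \<noteq> w" using joined_V[OF z] by auto
    have zv: "z \<noteq> v" using z D(15) X unfolding joined_def by auto
    obtain f' y where d': "defect f' u v w" and ch: "chained f (miss f v) (miss f w) z f' y"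
      by (rule defect_chain[OF d defect_miss_vw[OF d, symmetric] D(20,21) D(10,11) zV(1) eq])
    have "miss f' w = miss f w"
      by (rule chained_two(1)[OF ch D(5,4)]) (use zv zV D(7) defect_miss_vw[OF d] defect_miss_vw[OF d'] in auto)
    moreover have "f' {u, v} = f {u, v}" using chainedD(5)[OF ch, of "{u, v}"] X by auto
    moreover have "joined E f' (f {u, v}) w s" using chainedD(8)[OF ch s] X by auto
    moreover have "miss f' s = miss f s" using chainedD(3)[OF ch S(1)] X by auto
    moreover have "joined E f' (miss f s) w z" using chainedD(8)[OF ch z] X by auto
    ultimately show False using zw[OF d'] chainedD(1)[OF ch] by simp
  qed
qed

section \<open>The neighbour of \<open>s\<close> along \<open>j\<close>\<close>

lemma defect_t_distinct:
  assumes d: "defect f u v w" and s: "joined E f (f {u, v}) w s" and t: "joined E f j s t"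
  shows "t \<in> V" "t \<noteq> u" "t \<noteq> v" "t \<noteq> w" "t \<noteq> s" "miss f t \<noteq> j"
proof -
  note D = defectD[OF d]
  note S = defect_s_distinct[OF d s]
  have ts: "joined E f j t s" by (rule joined_sym[OF t])
  show "t \<in> V" "t \<noteq> s" using joined_V[OF t] by auto
  show "miss f t \<noteq> j" using not_joined_miss[OF D(1) ts] by blast
  then show "t \<noteq> u" using D(9) by blast
  show "t \<noteq> v" using joined_unique[OF D(1) D(14)] ts S(4) by blast
  show "t \<noteq> w" using joined_unique[OF D(1) D(15)] ts S(3) by blast
qed

lemma defect_edges_distinct:
  assumes d: "defect f u v w" and s: "joined E f (f {u, v}) w s" and t: "joined E f j s t"
  shows "{u, v} \<noteq> {v, w}" "{u, v} \<noteq> {w, s}" "{u, v} \<noteq> {s, t}" "{v, w} \<noteq> {w, s}" "{v, w} \<noteq> {s, t}"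
    "{w, s} \<noteq> {s, t}"
  using defectD(6-8)[OF d] defect_s_distinct(2-4)[OF d s] defect_t_distinct(2-5)[OF d s t]
  by (simp_all add: doubleton_eq_iff)

text \<open>If \<open>t\<close> misses \<open>c\<close>, recolour \<open>st\<close> to
  \<open>c\<close> and flip \<open>u\<close>, \<open>v\<close>, \<open>w\<close>, \<open>s\<close>.
  This gains \<open>uv\<close> and can lose only \<open>st\<close>, so \<open>st\<close> lies in
  \<open>M\<close> and the result is optimal again. It has a new defect whose rules, together with
  those of the old one, leave no missing colour for \<open>z\<close>.\<close>

lemma defect_miss_t_ne_s:
  assumes d: "defect f u v w" and s: "joined E f (f {u, v}) w s" and t: "joined E f j s t"
  shows "miss f t \<noteq> miss f s"
proof
  assume eq: "miss f t = miss f s"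
  note D = defectD[OF d]
  note S = defect_s_distinct[OF d s]
  note T = defect_t_distinct[OF d s t]
  note X = defect_colors[OF d s]
  note N = defect_edges_distinct[OF d s t] defect_edges_distinct[OF d s t, symmetric]
  define f1 where "f1 = f({s, t} := miss f s)"
  note r1 = recolor_edge[OF D(1) t refl eq, folded f1_def]
  have c1: "coloring E C f1" using kempe_reachable_coloring[OF r1(1) D(1)] .
  have j1: "joined E f1 (f {u, v}) u v" "joined E f1 j v w" "joined E f1 (f {u, v}) w s"
    unfolding f1_def
    by (rule joined_upd_other[OF D(16)] joined_upd_other[OF D(14)] joined_upd_other[OF s];
        rule N)+
  have mu: "miss f1 u = j" using r1(4)[OF D(3)] S T D(9) by auto
  define f2 where "f2 = f1({u, v} := j, {v, w} := f {u, v}, {w, s} := j)"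
  note r2 = flip_path3[OF c1 j1 mu r1(2), folded f2_def]
  have r: "reach f f2" by (rule rtranclp_trans[OF r1(1) r2(1)])
  have f2j: "f2 {u, v} = j" "f2 {w, s} = j" "f2 {s, t} = miss f s"
    unfolding f2_def f1_def using N by simp_all
  have keep: "f2 e = j" if "f e = j" "e \<in> M" "e \<noteq> {s, t}" for e
  proof -
    have "e \<noteq> {v, w}" using that(2) D(13) by blast
    then show ?thesis using that(1,3) unfolding f2_def f1_def by simp
  qed
  have stM: "{s, t} \<in> M"
  proof (rule ccontr)
    assume "{s, t} \<notin> M"
    then show False
      using opt_gain[OF D(2) r D(12,17) f2j(1)] keep by blast
  qed
  have "insert {u, v} (good f - {{s, t}}) \<subseteq> good f2"
    using D(12) f2j(1) keep unfolding good_def by auto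
  then have "card (insert {u, v} (good f - {{s, t}})) \<le> card (good f2)"
    by (rule card_mono[OF finite_good])
  moreover have "{s, t} \<in> good f" using stM t unfolding good_def joined_def by simp
  moreover have "{u, v} \<notin> good f" using D(17) unfolding good_def by simp
  ultimately have "card (good f) \<le> card (good f2)"
    using finite_good[of f] by (simp add: card_Suc_Diff1 del: card_Diff_insert)
  then have o2: "opt f2" by (rule opt_transfer[OF D(2) r])
  have m2: "miss f2 t = j" "miss f2 w = miss f w"
    using r2(4)[OF T(1)] r2(4)[OF D(5)] r1(4)[OF D(5)] r1(3) T S D by auto
  \<comment> \<open>The roles of \<open>u\<close>, \<open>v\<close> pass to \<open>t\<close>,
    \<open>s\<close>. The matching edge \<open>ts\<close> now has colour \<open>c\<close>, so
    \<open>z\<close> takes the role of \<open>s\<close>.\<close>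
  have d2: "defect f2 t s w"
    unfolding defect_def using o2 T(1) m2(1) stM f2j(2) s
    by (auto simp: insert_commute joined_def)
  have cst: "f2 {t, s} = miss f s" using f2j(3) by (simp add: insert_commute)
  obtain z where z: "joined E f (miss f s) w z"
    using joined_exists[OF D(1,5) X(3)] X(2) by auto
  have zne: "z \<noteq> s" "z \<noteq> v" using z s D(15) X(2) unfolding joined_def by auto
  have z2: "joined E f2 (miss f s) w z"
    unfolding f2_def f1_def
    by (intro joined_upd_other z) (use zne D S T in \<open>auto simp: doubleton_eq_iff\<close>)
  have zV: "z \<in> V" using joined_V[OF z] by blast
  have c2: "coloring E C f2" by (rule defectD(1)[OF d2])
  have ne: "miss f2 z \<noteq> j" "miss f2 z \<noteq> miss f w" "miss f2 z \<noteq> f {u, v}" "miss f2 z \<noteq> miss f s"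
    using defect_miss_s[OF d2, unfolded cst, OF z2] m2(2) r2(3) not_joined_miss[OF c2 joined_sym[OF z2]] by auto
  moreover have "miss f2 z \<in> C" by (rule miss_props(1)[OF c2 zV])
  ultimately have "miss f2 z = miss f v" using X(1) by auto
  moreover have "miss f2 z = miss f z"
  proof -
    have "z \<noteq> u" using ne(3) r2(2) by auto
    moreover have "z \<noteq> t" using ne(1) m2(1) by auto
    ultimately show ?thesis using r2(4)[OF zV] r1(4)[OF zV] zne(1) by auto
  qed
  ultimately show False using defect_miss_z(2)[OF d s z] by simp
qed

text \<open>If \<open>t\<close> missed \<open>d\<close> or \<open>b\<close>, a chain flip at
  \<open>t\<close> would turn this into \<open>c\<close>. The vertex \<open>x\<close>
  (\<open>v\<close> or \<open>w\<close>) and \<open>s\<close> must keep distinct missing colours, so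
  \<open>s\<close> still misses \<open>c\<close>, contrary to \<open>defect_miss_t_ne_s\<close>.
  Only \<open>a\<close> is left.\<close>

lemma defect_miss_t:
  assumes d: "defect f u v w" and s: "joined E f (f {u, v}) w s" and t: "joined E f j s t"
  shows "miss f t = f {u, v}"
proof -
  note D = defectD[OF d]
  note S = defect_s_distinct[OF d s]
  note T = defect_t_distinct[OF d s t]
  note X = defect_colors[OF d s]
  have no: False if x: "x \<in> {v, w}" and eq: "miss f t = miss f x" for x
  proof -
    have xV: "x \<in> V" "x \<noteq> t" "x \<noteq> s" "miss f x \<in> C" "miss f x \<noteq> j" "miss f x \<noteq> miss f s"
      and ca: "f {u, v} \<notin> {miss f x, miss f s}"
      using x D S T X by auto
    obtain f' y where d': "defect f' u v w" and ch: "chained f (miss f x) (miss f s) t f' y"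
      by (rule defect_chain[OF d xV(6,4) X(3) xV(5) _ T(1) eq]) (use X in auto)
    have uv: "f' {u, v} = f {u, v}" by (rule chainedD(5)[OF ch ca])
    have s': "joined E f' (f' {u, v}) w s" unfolding uv by (rule chainedD(8)[OF ch s ca])
    have "miss f' x \<noteq> miss f' s" using defect_miss_s(2,3)[OF d' s'] x by auto
    then have "miss f' s = miss f s"
      using chained_two(2)[OF ch xV(1) S(1) xV(2) T(5)[symmetric] xV(3)] xV(6) by simp
    moreover have "joined E f' j s t" by (rule chainedD(8)[OF ch t]) (use xV X in auto)
    ultimately show False using defect_miss_t_ne_s[OF d' s'] chainedD(1)[OF ch] by simp
  qed
  have "miss f t \<noteq> miss f v" "miss f t \<noteq> miss f w" using no by blast+
  moreover have "miss f t \<in> C" by (rule miss_props(1)[OF D(1) T(1)])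
  ultimately show ?thesis using X(1) T(6) defect_miss_t_ne_s[OF d s t] by auto
qed

section \<open>Excluding the defect\<close>

text \<open>Recolouring \<open>wp\<close> from \<open>d\<close> to \<open>b\<close> would make both
  \<open>w\<close> and \<open>v\<close> miss \<open>d\<close>.\<close>

lemma defect_p_miss_w:
  assumes d: "defect f u v w" and p: "joined E f (miss f v) w p"
  shows "miss f p \<noteq> miss f w"
proof
  assume eq: "miss f p = miss f w"
  note D = defectD[OF d]
  have pv: "p \<noteq> v" using p D(10,15) unfolding joined_def by auto
  have d': "defect (f({w, p} := miss f w)) u v w"
    by (rule defect_recolor[OF d p refl eq]) (use D in auto)
  have "miss (f({w, p} := miss f w)) w = miss f v" by (rule recolor_edge(2)[OF D(1) p refl eq])
  moreover have "miss (f({w, p} := miss f w)) v = miss f v"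
    by (rule recolor_edge(4)[OF D(1) p refl eq D(4)]) (use D pv in auto)
  ultimately show False using defect_miss_vw[OF d'] by simp
qed

text \<open>If \<open>p\<close> misses \<open>c\<close>, a chain flip at \<open>p\<close> turns it
  into \<open>b\<close> while \<open>s\<close> and \<open>w\<close> stay fixed. If \<open>p\<close>
  misses \<open>j\<close> and differs from \<open>u\<close>, flipping \<open>v\<close>,
  \<open>w\<close>, \<open>p\<close> in the colours \<open>j\<close>, \<open>d\<close> frees
  \<open>j\<close> at \<open>v\<close>, and \<open>uv\<close> can be recoloured.\<close>

lemma defect_p:
  assumes d: "defect f u v w" and s: "joined E f (f {u, v}) w s" and p: "joined E f (miss f v) w p"
  shows "p = u \<or> miss f p = f {u, v}"
proof -
  note D = defectD[OF d]
  note S = defect_s_distinct[OF d s]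
  note X = defect_colors[OF d s]
  have pV: "p \<in> V" "p \<noteq> w" using joined_V[OF p] by auto
  have ps: "p \<noteq> s" using p s X(2) unfolding joined_def by auto
  have pv: "p \<noteq> v" using p D(10,15) unfolding joined_def by auto
  have "miss f p \<noteq> miss f s"
  proof
    assume eq: "miss f p = miss f s"
    obtain f' y where d': "defect f' u v w" and ch: "chained f (miss f s) (miss f w) p f' y"
      by (rule defect_chain[OF d _ X(3) D(21) _ D(11) pV(1) eq]) (use X in auto)
    have uv: "f' {u, v} = f {u, v}" by (rule chainedD(5)[OF ch]) (use X in auto)
    have s': "joined E f' (f' {u, v}) w s" unfolding uv by (rule chainedD(8)[OF ch s]) (use X in auto)
    have w': "miss f' w = miss f w"
      by (rule chained_two(1)[OF ch D(5) S(1)])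
        (use S pV ps X defect_miss_s(2)[OF d' s'] in auto)
    have v': "miss f' v = miss f v" by (rule chainedD(3)[OF ch D(4)]) (use X in auto)
    have "joined E f' (miss f' v) w p" unfolding v' by (rule chainedD(8)[OF ch p]) (use X in auto)
    then show False using defect_p_miss_w[OF d'] chainedD(1)[OF ch] w' by simp
  qed
  moreover have "miss f p = j \<longrightarrow> p = u"
  proof (rule impI, rule ccontr)
    assume eq: "miss f p = j" and pu: "p \<noteq> u"
    define f1 where "f1 = f({v, w} := miss f v, {w, p} := j)"
    have r1: "reach f f1" "miss f1 v = j" "miss f1 u = j"
      using flip_path2[OF D(1) D(14) p refl eq] D pu unfolding f1_def by auto
    have c1: "coloring E C f1" using kempe_reachable_coloring[OF r1(1) D(1)] .
    have uv: "joined E f1 (f {u, v}) u v"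
      unfolding f1_def by (intro joined_upd_other D(16)) (use D pu in \<open>auto simp: doubleton_eq_iff\<close>)
    note r2 = recolor_edge(1)[OF c1 uv r1(3,2)]
    show False
      by (rule opt_gain[OF D(2) rtranclp_trans[OF r1(1) r2] D(12)])
        (use D(13,17) in \<open>auto simp: f1_def\<close>)
  qed
  moreover have "miss f p \<noteq> miss f v" using not_joined_miss[OF D(1) joined_sym[OF p]] by blast
  moreover have "miss f p \<in> C" by (rule miss_props(1)[OF D(1) pV(1)])
  ultimately show ?thesis using X(1) defect_p_miss_w[OF d p] by auto
qed

text \<open>Suppose \<open>z\<close> misses \<open>j\<close> and differs from \<open>u\<close>. Flip
  the path \<open>u\<close>, \<open>v\<close>, \<open>w\<close>, \<open>s\<close>, \<open>t\<close>
  in the colours \<open>a\<close>, \<open>j\<close>, then \<open>s\<close>, \<open>w\<close>,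
  \<open>z\<close> in \<open>j\<close>, \<open>c\<close>. Now \<open>s\<close> and \<open>t\<close>
  both miss \<open>j\<close>, so \<open>st\<close> gets \<open>j\<close> back: \<open>uv\<close> is
  gained and no good edge is lost.\<close>

lemma defect_z:
  assumes d: "defect f u v w" and s: "joined E f (f {u, v}) w s" and t: "joined E f j s t"
    and z: "joined E f (miss f s) w z"
  shows "z = u \<or> miss f z = f {u, v}"
proof -
  note D = defectD[OF d]
  note S = defect_s_distinct[OF d s]
  note T = defect_t_distinct[OF d s t]
  note X = defect_colors[OF d s]
  have zV: "z \<in> V" "z \<noteq> w" using joined_V[OF z] by auto
  have zne: "z \<noteq> s" "z \<noteq> v" using z s D(15) X(2) unfolding joined_def by auto
  have "miss f z = j \<longrightarrow> z = u"
  proof (rule impI, rule ccontr)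
    assume eq: "miss f z = j" and zu: "z \<noteq> u"
    have zt: "z \<noteq> t" using T(6) eq by blast
    define f1 where "f1 = f({u, v} := j, {v, w} := f {u, v}, {w, s} := j, {s, t} := f {u, v})"
    note r1 = flip_path4[OF D(1) D(16) D(14) s t D(9) defect_miss_t[OF d s t], folded f1_def]
    have c1: "coloring E C f1" using kempe_reachable_coloring[OF r1(1) D(1)] .
    have sw: "joined E f1 j s w"
      using s S T unfolding f1_def joined_def by (auto simp: doubleton_eq_iff insert_commute)
    have wz: "joined E f1 (miss f s) w z"
      unfolding f1_def by (intro joined_upd_other z) (use D S T zne zu zt in \<open>auto simp: doubleton_eq_iff\<close>)
    have ms: "miss f1 s = miss f s" "miss f1 z = j"
      using r1(4)[OF S(1)] r1(4)[OF zV(1)] S T zu zt eq by auto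
    define f2 where "f2 = f1({s, w} := miss f s, {w, z} := j)"
    note r2 = flip_path2[OF c1 sw wz ms, folded f2_def]
    have c2: "coloring E C f2" using kempe_reachable_coloring[OF r2(1) c1] .
    have st: "joined E f2 (f {u, v}) s t"
      using t S T zne zu zt D unfolding f2_def f1_def joined_def by (auto simp: doubleton_eq_iff)
    have m2: "miss f2 s = j" "miss f2 t = j" using r2(2) r2(4)[OF T(1)] r1(3) T zt by auto
    note r3 = recolor_edge(1)[OF c2 st m2]
    have r: "reach f (f2({s, t} := j))" using r1(1) r2(1) r3 by (meson rtranclp_trans)
    show False
    proof (rule opt_gain[OF D(2) r D(12,17)])
      show "(f2({s, t} := j)) {u, v} = j"
        unfolding f2_def f1_def using D S T zne by (auto simp: doubleton_eq_iff)
      have wsj: "f {w, s} \<noteq> j" using s D(17) unfolding joined_def by simp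
      show "(f2({s, t} := j)) e = j" if "e \<in> M" "f e = j" for e
      proof -
        have "{s, w} = {w, s}" by (rule insert_commute)
        moreover have "e \<noteq> {v, w}" "e \<noteq> {w, s}" using that D(13) wsj by blast+
        ultimately show ?thesis using that(2) unfolding f2_def f1_def by simp
      qed
    qed
  qed
  moreover have "miss f z \<noteq> miss f s" using not_joined_miss[OF D(1) joined_sym[OF z]] by blast
  moreover have "miss f z \<in> C" by (rule miss_props(1)[OF D(1) zV(1)])
  ultimately show ?thesis using X(1) defect_miss_z[OF d s z] by auto
qed

lemma no_defect: "\<not> defect f u v w"
proof
  assume d: "defect f u v w"
  note D = defectD[OF d]
  obtain s where s: "joined E f (f {u, v}) w s" by (rule defect_s_exists[OF d])
  note S = defect_s_distinct[OF d s]
  note X = defect_colors[OF d s]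
  obtain t where t: "joined E f j s t" using joined_exists[OF D(1) S(1) j_C] X(2) by auto
  note T = defect_t_distinct[OF d s t]
  note mt = defect_miss_t[OF d s t]
  note N = defect_edges_distinct[OF d s t]
  obtain p where p: "joined E f (miss f v) w p" using joined_exists[OF D(1,5,20)] X(2) by auto
  obtain z where z: "joined E f (miss f s) w z" using joined_exists[OF D(1,5) X(3)] X(2) by auto
  have pV: "p \<in> V" "p \<noteq> w" and zV: "z \<in> V" "z \<noteq> w" using joined_V[OF p] joined_V[OF z] by auto
  \<comment> \<open>Exchange \<open>b\<close> and \<open>a\<close> along the chain at
    \<open>w\<close>, so that \<open>w\<close> misses \<open>a\<close>. By
    \<open>defect_miss_w\<close> for \<open>f'\<close>, the edge \<open>uv\<close> must then have
    changed to \<open>b\<close>, and \<open>s\<close> remains the neighbour of \<open>w\<close>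
    along the colour of \<open>uv\<close>.\<close>
  obtain f' y where d': "defect f' u v w" and ch: "chained f (miss f w) (f {u, v}) w f' y"
    by (rule defect_chain[OF d _ D(21,19) D(11) D(17) D(5) refl]) (use X in auto)
  have w': "miss f' w = f {u, v}" by (rule chainedD(1)[OF ch])
  have v': "miss f' v = miss f v" by (rule chainedD(3)[OF ch D(4)]) (use X in auto)
  have ms': "miss f' s = miss f s" by (rule chainedD(3)[OF ch S(1)]) (use X in auto)
  have uv': "f' {u, v} = miss f w"
    using chainedD(6)[OF ch, of "{u, v}"] defect_miss_w[OF d'] w' by auto
  have c': "coloring E C f'" by (rule defectD(1)[OF d'])
  have s': "joined E f' (f' {u, v}) w s"
  proof -
    have e: "{w, s} \<in> E" "f {w, s} = f {u, v}" using s unfolding joined_def by auto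
    then have "f' {w, s} \<in> {miss f w, f {u, v}}" using chainedD(6)[OF ch, of "{w, s}"] by auto
    moreover have "f' {w, s} \<noteq> f {u, v}" using miss_props(2)[OF c' D(5) e(1)] w' by auto
    ultimately show ?thesis using e(1) uv' unfolding joined_def by auto
  qed
  have t': "joined E f' j s t" by (rule chainedD(8)[OF ch t]) (use X in auto)
  have p': "joined E f' (miss f' v) w p" unfolding v' by (rule chainedD(8)[OF ch p]) (use X in auto)
  have z': "joined E f' (miss f' s) w z" unfolding ms' by (rule chainedD(8)[OF ch z]) (use X in auto)
  text \<open>An unchanged vertex missing the colour of uv would miss the same colour as w after the flip;
    so t, p and z all compete for the other end of the chain.\<close>
  have "miss f' t = miss f w" using defect_miss_t[OF d' s' t'] uv' by simp
  then have "miss f' t \<noteq> miss f t" using mt X(2) by auto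
  then have yt: "y = t" using chainedD(2)[OF ch T(1) T(4)] by blast
  have "p = u \<or> p = t"
  proof (rule ccontr)
    assume *: "\<not> (p = u \<or> p = t)"
    then have "miss f p = f {u, v}" using defect_p[OF d s p] by blast
    then have "miss f' p = miss f' w" using chainedD(2)[OF ch pV] * yt w' by simp
    then show False using defect_p_miss_w[OF d' p'] by simp
  qed
  moreover have "z = u \<or> z = t"
  proof (rule ccontr)
    assume *: "\<not> (z = u \<or> z = t)"
    then have "miss f z = f {u, v}" using defect_z[OF d s t z] by blast
    then have "miss f' z = miss f' w" using chainedD(2)[OF ch zV] * yt w' by simp
    then show False using defect_miss_z(1)[OF d' s' z'] by simp
  qed
  \<comment> \<open>Otherwise flipping \<open>u\<close>, \<open>v\<close>, \<open>w\<close>,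
    \<open>s\<close>, \<open>t\<close> gains \<open>uv\<close> and loses nothing.\<close>
  moreover have st: "{s, t} \<in> M"
  proof (rule ccontr)
    assume st: "{s, t} \<notin> M"
    show False
    proof (rule opt_gain[OF D(2) flip_path4(1)[OF D(1) D(16) D(14) s t D(9) mt] D(12,17)], goal_cases)
      case 1
      show ?case using N by simp
    next
      case (2 e)
      then have "e \<noteq> {v, w}" "e \<noteq> {s, t}" using D(13) st by blast+
      then show ?case using 2(2) by simp
    qed
  qed
  moreover obtain q where q: "{w, q} \<in> M"
  proof -
    obtain e where "e \<in> M" "w \<in> e" using M_perfect[OF D(5)] by blast
    then show thesis using that edge_other_end[of e w] M_E by blast
  qed
  \<comment> \<open>The partner of \<open>w\<close> in \<open>M\<close> is one of its four
    neighbours, all of which lie among \<open>u\<close>, \<open>v\<close>, \<open>s\<close>,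
    \<open>t\<close>. These are already matched by \<open>uv\<close> and \<open>st\<close>.\<close>
  moreover have "q = v \<or> q = s \<or> q = p \<or> q = z"
  proof -
    have q': "joined E f (f {w, q}) w q" using q M_E unfolding joined_def by blast
    then have "f {w, q} \<in> C" "f {w, q} \<noteq> miss f w" using not_joined_miss[OF D(1) q'] by auto
    then have "f {w, q} \<in> {j, f {u, v}, miss f v, miss f s}" using X(1) by auto
    then show ?thesis
      using joined_unique[OF D(1) q'] D(15) s p z by auto
  qed
  moreover have "{v, u} \<in> M" "{t, s} \<in> M" "{v, w} \<notin> M" using D(12,13) st by (simp_all add: insert_commute)
  ultimately have "{w, q} \<in> M" "q \<in> {u, s, t}" using D by (auto simp: insert_commute)
  then show False
    using M_unique[of u v w] M_unique[of s t w] M_unique[of t s w] D(7,8,12) S T st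
    by (auto simp: insert_commute)
qed

subsection \<open>Edges of the matching colour outside the matching\<close>

text \<open>If the partner \<open>v\<close> of \<open>u\<close> also misses \<open>j\<close>,
  recolour \<open>uv\<close>; otherwise the \<open>j\<close>-edge at \<open>v\<close> completes a
  defect.\<close>

lemma opt_no_full:
  assumes o: "opt f" and u: "u \<in> V"
  shows "miss f u \<noteq> j"
proof
  assume mu: "miss f u = j"
  have c: "coloring E C f" using o by (simp add: opt_def)
  obtain e where "e \<in> M" "u \<in> e" using M_perfect[OF u] by blast
  then obtain v where v: "{u, v} \<in> M" using edge_other_end[of e u] M_E by blast
  then have uv: "joined E f (f {u, v}) u v" using M_E unfolding joined_def by blast
  have vV: "v \<in> V" using joined_V[OF uv] by blast
  have ne: "f {u, v} \<noteq> j" using not_joined_miss[OF c uv] mu by auto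
  show False
  proof (cases "miss f v = j")
    case True
    show False
      by (rule opt_gain[OF o recolor_edge(1)[OF c uv mu True] v ne]) simp_all
  next
    case False
    then obtain w where "joined E f j v w" using joined_exists[OF c vV j_C] by auto
    then have "defect f u v w" using o u mu v by (simp add: defect_def)
    then show False using no_defect by blast
  qed
qed

section \<open>Fans at an end of a misplaced edge\<close>

definition misplaced :: "('a set \<Rightarrow> nat) \<Rightarrow> 'a \<Rightarrow> 'a \<Rightarrow> bool" where
  "misplaced f v w \<longleftrightarrow> opt f \<and> joined E f j v w \<and> {v, w} \<notin> M"

lemma misplacedD:
  assumes "misplaced f v w"
  shows "coloring E C f" "opt f" "v \<in> V" "w \<in> V" "v \<noteq> w" "joined E f j v w" "{v, w} \<notin> M"
    "miss f v \<in> C" "miss f w \<in> C" "miss f v \<noteq> j" "miss f w \<noteq> j"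
proof -
  show c: "coloring E C f" and o: "opt f" and vw: "joined E f j v w" and "{v, w} \<notin> M"
    using assms unfolding misplaced_def opt_def by auto
  show V: "v \<in> V" "w \<in> V" "v \<noteq> w" using joined_V[OF vw] by auto
  show "miss f v \<in> C" "miss f w \<in> C" using miss_props(1)[OF c] V by auto
  show "miss f v \<noteq> j" "miss f w \<noteq> j" using opt_no_full[OF o] V by auto
qed

lemma misplaced_transfer:
  assumes "misplaced f v w" "reach f f'" "\<And>e. f' e = j \<longleftrightarrow> f e = j"
  shows "misplaced f' v w"
  using assms opt_same[of f f'] unfolding misplaced_def joined_def by blast

lemma misplaced_recolor:
  assumes m: "misplaced f v w" and xy: "joined E f a x y" "miss f x = b" "miss f y = b"
    and j: "a \<noteq> j" "b \<noteq> j"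
  shows "misplaced (f({x, y} := b)) v w"
proof (rule misplaced_transfer[OF m])
  show "reach f (f({x, y} := b))" by (rule recolor_edge(1)[OF misplacedD(1)[OF m] xy])
  show "(f({x, y} := b)) e = j \<longleftrightarrow> f e = j" for e using xy(1) j unfolding joined_def by auto
qed

lemma misplaced_chain:
  assumes m: "misplaced f v w" and ab: "a \<noteq> b" "a \<in> C" "b \<in> C" "a \<noteq> j" "b \<noteq> j"
    and x: "x \<in> V" "miss f x = a"
  obtains f' y where "misplaced f' v w" "chained f a b x f' y"
proof -
  obtain f' y where *: "reach f f'" "chained f a b x f' y"
    by (rule chain_flip[OF misplacedD(1)[OF m] ab(1-3) x])
  have "misplaced f' v w"
  proof (rule misplaced_transfer[OF m *(1)])
    show "f' e = j \<longleftrightarrow> f e = j" for e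
      using chainedD(5,6)[OF *(2), of e] ab(4,5) by (cases "f e \<in> {a, b}") auto
  qed
  then show thesis using that *(2) by blast
qed

text \<open>Giving \<open>vw\<close> the common missing colour costs no good edge, but makes
  \<open>v\<close> miss \<open>j\<close>.\<close>

lemma misplaced_miss:
  assumes m: "misplaced f v w"
  shows "miss f w \<noteq> miss f v"
proof
  assume eq: "miss f w = miss f v"
  note P = misplacedD[OF m]
  note r = recolor_edge[OF P(1) P(6) refl eq]
  have "opt (f({v, w} := miss f v))"
    by (rule opt_same[OF P(2) r(1)]) (use P(7) in auto)
  then show False using opt_no_full[OF _ P(3)] r(2) by blast
qed

text \<open>First shift of a Vizing fan \<open>w\<close>, \<open>x\<close>, \<open>y\<close>,
  \<open>t\<close> at \<open>v\<close>, in which the edge to each new vertex has the colour missing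
  at the previous one. Recolouring \<open>vx\<close> makes \<open>v\<close> and \<open>w\<close>
  miss the same colour.\<close>

lemma misplaced_fan1:
  assumes m: "misplaced f v w" and x: "joined E f (miss f w) v x"
  shows "miss f x \<noteq> miss f v"
proof
  assume eq: "miss f x = miss f v"
  note P = misplacedD[OF m]
  have xw: "x \<noteq> w" using x P(6,11) unfolding joined_def by auto
  note r = recolor_edge[OF P(1) x refl eq]
  have "misplaced (f({v, x} := miss f v)) v w"
    by (rule misplaced_recolor[OF m x refl eq]) (use P in auto)
  then have "miss (f({v, x} := miss f v)) w \<noteq> miss (f({v, x} := miss f v)) v"
    by (rule misplaced_miss)
  then show False using r(2) r(4)[OF P(4)] P(5) xw by auto
qed

text \<open>Recolouring \<open>vy\<close> shortens the fan and gives the first claim. For the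
  second, a chain flip at \<open>y\<close> turns the colour missing at \<open>w\<close> into the one
  missing at \<open>v\<close>; as \<open>v\<close> and \<open>w\<close> are protected, the first
  claim applies.\<close>

lemma misplaced_fan2:
  assumes m: "misplaced f v w" and x: "joined E f (miss f w) v x" and y: "joined E f (miss f x) v y"
  shows "miss f y \<noteq> miss f v" "miss f y \<noteq> miss f w"
proof -
  have yv: False if m: "misplaced f v w" and x: "joined E f (miss f w) v x"
      and y: "joined E f (miss f x) v y" and eq: "miss f y = miss f v" for f
  proof -
    note P = misplacedD[OF m]
    have V: "x \<in> V" "v \<noteq> x" "y \<in> V" "v \<noteq> y" using joined_V[OF x] joined_V[OF y] by auto
    have mx: "miss f x \<noteq> j" "miss f x \<noteq> miss f w"
      using opt_no_full[OF P(2) V(1)] not_joined_miss[OF P(1) joined_sym[OF x]] by auto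
    have ne: "y \<noteq> w" "y \<noteq> x" using x y P(6) mx unfolding joined_def by auto
    let ?f = "f({v, y} := miss f v)"
    note r = recolor_edge[OF P(1) y refl eq]
    have m': "misplaced ?f v w"
      by (rule misplaced_recolor[OF m y refl eq]) (use P mx in auto)
    have "miss ?f w = miss f w" using r(4)[OF P(4)] P(5) ne by auto
    moreover have "joined E ?f (miss f w) v x"
      by (rule joined_upd_other[OF x]) (use ne in \<open>auto simp: doubleton_eq_iff\<close>)
    moreover have "miss ?f x = miss f x" using r(4)[OF V(1)] V ne by auto
    ultimately show False using misplaced_fan1[OF m', of x] r(2) by simp
  qed
  show "miss f y \<noteq> miss f v" using yv[OF m x y] by blast
  show "miss f y \<noteq> miss f w"
  proof
    assume eq: "miss f y = miss f w"
    note P = misplacedD[OF m]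
    have V: "x \<in> V" "v \<noteq> x" "y \<in> V" "v \<noteq> y" using joined_V[OF x] joined_V[OF y] by auto
    have mx: "miss f x \<noteq> j" "miss f x \<noteq> miss f w" "miss f x \<noteq> miss f v"
      using opt_no_full[OF P(2) V(1)] not_joined_miss[OF P(1) joined_sym[OF x]]
        misplaced_fan1[OF m x] by auto
    have ne: "y \<noteq> w" using y P(6) mx unfolding joined_def by auto
    obtain f' q where m': "misplaced f' v w" and ch: "chained f (miss f w) (miss f v) y f' q"
      by (rule misplaced_chain[OF m misplaced_miss[OF m] P(9,8,11,10) V(3) eq])
    have vw': "miss f' v = miss f v" "miss f' w = miss f w"
      using chained_two[OF ch P(3,4) V(4) ne[symmetric] P(5)] misplaced_miss[OF m] misplaced_miss[OF m'] by auto
    \<comment> \<open>The colour of \<open>vx\<close> is one of the two exchanged, but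
      \<open>v\<close> kept its missing colour and therefore lies off the chain.\<close>
    have "joined E f' (miss f w) v x" by (rule chainedD(7)[OF ch x]) (use vw' in auto)
    moreover have "miss f' x = miss f x" by (rule chainedD(3)[OF ch V(1)]) (use mx in auto)
    moreover have "joined E f' (miss f x) v y" by (rule chainedD(8)[OF ch y]) (use mx in auto)
    ultimately show False using yv[OF m'] vw' chainedD(1)[OF ch] by simp
  qed
qed

text \<open>As for \<open>misplaced_fan2\<close>, one vertex further. In the last claim the chain
  uses the colours missing at \<open>x\<close> and \<open>v\<close>, and
  \<open>misplaced_fan1\<close> for \<open>f'\<close> protects these two vertices.\<close>

lemma misplaced_fan3:
  assumes m: "misplaced f v w" and x: "joined E f (miss f w) v x" and y: "joined E f (miss f x) v y"
    and t: "joined E f (miss f y) v t"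
  shows "miss f t \<noteq> miss f v" "miss f t \<noteq> miss f w" "miss f t \<noteq> miss f x"
proof -
  have facts: "x \<in> V" "v \<noteq> x" "y \<in> V" "v \<noteq> y" "t \<in> V" "v \<noteq> t"
    "distinct [j, miss f v, miss f w, miss f x, miss f y]" "t \<noteq> w" "t \<noteq> x" "t \<noteq> y"
    "y \<noteq> x" "x \<noteq> w" "y \<noteq> w" "miss f x \<in> C"
    if m: "misplaced f v w" and x: "joined E f (miss f w) v x" and y: "joined E f (miss f x) v y"
      and t: "joined E f (miss f y) v t" for f
  proof -
    note P = misplacedD[OF m]
    show V: "x \<in> V" "v \<noteq> x" "y \<in> V" "v \<noteq> y" "t \<in> V" "v \<noteq> t"
      using joined_V[OF x] joined_V[OF y] joined_V[OF t] by auto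
    show d: "distinct [j, miss f v, miss f w, miss f x, miss f y]"
      using P(10,11) opt_no_full[OF P(2) V(1)] opt_no_full[OF P(2) V(3)] misplaced_miss[OF m]
        not_joined_miss[OF P(1) joined_sym[OF x]] not_joined_miss[OF P(1) joined_sym[OF y]]
        misplaced_fan1[OF m x] misplaced_fan2[OF m x y] by auto
    show "t \<noteq> w" "t \<noteq> x" "t \<noteq> y" "y \<noteq> x" "x \<noteq> w" "y \<noteq> w"
      using x y t P(6) d unfolding joined_def by auto
    show "miss f x \<in> C" by (rule miss_props(1)[OF P(1) V(1)])
  qed
  have tv: False if m: "misplaced f v w" and x: "joined E f (miss f w) v x"
      and y: "joined E f (miss f x) v y" and t: "joined E f (miss f y) v t"
      and eq: "miss f t = miss f v" for f
  proof -
    note P = misplacedD[OF m]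
    note F = facts[OF m x y t]
    let ?f = "f({v, t} := miss f v)"
    note r = recolor_edge[OF P(1) t refl eq]
    have m': "misplaced ?f v w"
      by (rule misplaced_recolor[OF m t refl eq]) (use F in auto)
    have "miss ?f w = miss f w" "miss ?f x = miss f x" "miss ?f y = miss f y"
      using r(4)[OF P(4)] r(4)[OF F(1)] r(4)[OF F(3)] P(5) F by auto
    moreover have "joined E ?f (miss f w) v x" "joined E ?f (miss f x) v y"
      by (rule joined_upd_other[OF x] joined_upd_other[OF y]; use F in \<open>simp add: doubleton_eq_iff\<close>)+
    ultimately show False using misplaced_fan2(1)[OF m', of x y] r(2) by simp
  qed
  note P = misplacedD[OF m]
  note F = facts[OF m x y t]
  show "miss f t \<noteq> miss f v" using tv[OF m x y t] by blast
  show "miss f t \<noteq> miss f w"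
  proof
    assume eq: "miss f t = miss f w"
    obtain f' q where m': "misplaced f' v w" and ch: "chained f (miss f w) (miss f v) t f' q"
      by (rule misplaced_chain[OF m misplaced_miss[OF m] P(9,8,11,10) F(5) eq])
    have vw': "miss f' v = miss f v" "miss f' w = miss f w"
      using chained_two[OF ch P(3,4) F(6) F(8)[symmetric] P(5)] misplaced_miss[OF m] misplaced_miss[OF m'] by auto
    have "joined E f' (miss f w) v x" by (rule chainedD(7)[OF ch x]) (use vw' in auto)
    moreover have "miss f' x = miss f x" by (rule chainedD(3)[OF ch F(1)]) (use F in auto)
    moreover have "joined E f' (miss f x) v y" by (rule chainedD(8)[OF ch y]) (use F in auto)
    moreover have "miss f' y = miss f y" by (rule chainedD(3)[OF ch F(3)]) (use F in auto)
    moreover have "joined E f' (miss f y) v t" by (rule chainedD(8)[OF ch t]) (use F in auto)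
    ultimately show False using tv[OF m'] vw' chainedD(1)[OF ch] by simp
  qed
  show "miss f t \<noteq> miss f x"
  proof
    assume eq: "miss f t = miss f x"
    obtain f' q where m': "misplaced f' v w" and ch: "chained f (miss f x) (miss f v) t f' q"
      by (rule misplaced_chain[OF m _ F(14) P(8) _ P(10) F(5) eq]) (use F in auto)
    have w': "miss f' w = miss f w" by (rule chainedD(3)[OF ch P(4)]) (use F in auto)
    have x': "joined E f' (miss f' w) v x" unfolding w' by (rule chainedD(8)[OF ch x]) (use F in auto)
    have vx': "miss f' v = miss f v" "miss f' x = miss f x"
      using chained_two[OF ch P(3) F(1) F(6) F(9)[symmetric] F(2)] F(7) misplaced_fan1[OF m' x'] by auto
    have "joined E f' (miss f x) v y" by (rule chainedD(7)[OF ch y]) (use vx' in auto)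
    moreover have "miss f' y = miss f y" by (rule chainedD(3)[OF ch F(3)]) (use F in auto)
    moreover have "joined E f' (miss f y) v t" by (rule chainedD(8)[OF ch t]) (use F in auto)
    ultimately show False using tv[OF m' x'] vx' chainedD(1)[OF ch] by simp
  qed
qed

text \<open>The colours missing at \<open>v\<close>, \<open>w\<close>, \<open>x\<close>,
  \<open>y\<close> together with \<open>j\<close> exhaust \<open>C\<close>, yet \<open>t\<close> can
  miss none of them.\<close>

lemma no_misplaced: "\<not> misplaced f v w"
proof
  assume m: "misplaced f v w"
  note P = misplacedD[OF m]
  obtain x where x: "joined E f (miss f w) v x"
    using joined_exists[OF P(1,3,9)] misplaced_miss[OF m] by blast
  have xV: "x \<in> V" using joined_V[OF x] by blast
  have mx: "miss f x \<in> C" "miss f x \<noteq> j" "miss f x \<noteq> miss f w" "miss f x \<noteq> miss f v"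
    using miss_props(1)[OF P(1) xV] opt_no_full[OF P(2) xV]
      not_joined_miss[OF P(1) joined_sym[OF x]] misplaced_fan1[OF m x] by auto
  obtain y where y: "joined E f (miss f x) v y"
    using joined_exists[OF P(1,3) mx(1,4)] by blast
  have yV: "y \<in> V" using joined_V[OF y] by blast
  have my: "miss f y \<in> C" "miss f y \<noteq> j" "miss f y \<noteq> miss f x"
    using miss_props(1)[OF P(1) yV] opt_no_full[OF P(2) yV]
      not_joined_miss[OF P(1) joined_sym[OF y]] by auto
  note my2 = misplaced_fan2[OF m x y]
  obtain t where t: "joined E f (miss f y) v t"
    using joined_exists[OF P(1,3) my(1) my2(1)] by blast
  have tV: "t \<in> V" using joined_V[OF t] by blast
  have "C = {j, miss f v, miss f w, miss f x, miss f y}"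
    by (rule five_colors) (use j_C P mx my my2 misplaced_miss[OF m] in auto)
  moreover have "miss f t \<in> C" "miss f t \<noteq> j" "miss f t \<noteq> miss f y"
    using miss_props(1)[OF P(1) tV] opt_no_full[OF P(2) tV]
      not_joined_miss[OF P(1) joined_sym[OF t]] by auto
  ultimately show False using misplaced_fan3[OF m x y t] by auto
qed

lemma opt_color_class:
  assumes o: "opt f" and e: "e \<in> E"
  shows "f e = j \<longleftrightarrow> e \<in> M"
proof
  have c: "coloring E C f" using o by (simp add: opt_def)
  show M: "e \<in> M" if ej: "f e = j"
  proof (rule ccontr)
    assume "e \<notin> M"
    moreover obtain v w where "e = {v, w}" using edge_pair[OF e] by blast
    ultimately have "misplaced f v w" using o e ej unfolding misplaced_def joined_def by simp
    then show False using no_misplaced by blast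
  qed
  assume "e \<in> M"
  obtain v w where vw: "e = {v, w}" "v \<in> V" using edge_pair[OF e] by blast
  obtain x where x: "joined E f j v x"
    using joined_exists[OF c vw(2) j_C] opt_no_full[OF o vw(2)] by auto
  then have "{v, x} \<notin> M \<Longrightarrow> misplaced f v x" using o unfolding misplaced_def by simp
  then have "{v, x} \<in> M" using no_misplaced by blast
  then show "f e = j" using M_unique[of v x w] \<open>e \<in> M\<close> vw x unfolding joined_def by simp
qed

lemma reach_color_class:
  assumes "coloring E C f"
  obtains f' where "reach f f'" "\<And>e. e \<in> E \<Longrightarrow> f' e = j \<longleftrightarrow> e \<in> M"
proof -
  have bound: "card (good h) < Suc (card E)" for h
    unfolding less_Suc_eq_le by (rule card_mono[OF finite_E]) (use M_E good_def in auto)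
  have "\<exists>h. reach f h \<and> (\<forall>h'. reach f h' \<longrightarrow> card (good h') \<le> card (good h))"
  proof (rule ex_has_greatest_nat[where P = "reach f" and k = f and f = "\<lambda>h. card (good h)"])
    show "reach f f" by (rule rtranclp.rtrancl_refl)
    show "\<forall>h. reach f h \<longrightarrow> card (good h) < Suc (card E)" using bound by (intro allI impI)
  qed
  then obtain f' where f': "reach f f'"
    and max: "\<forall>h. reach f h \<longrightarrow> card (good h) \<le> card (good f')"
    by (elim exE conjE)
  have "opt f'"
    unfolding opt_def
  proof (intro conjI allI impI)
    show "coloring E C f'" by (rule kempe_reachable_coloring[OF f' assms])
    show "card (good h) \<le> card (good f')" if "reach f' h" for h
      using max rtranclp_trans[OF f' that] by simp
  qed
  then have "f' e = j \<longleftrightarrow> e \<in> M" if "e \<in> E" for e using opt_color_class that by blast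
  then show thesis by (rule that[OF f'])
qed

end

subsection \<open>Induction on the degree\<close>

text \<open>Since \<open>M\<close> is exactly the class \<open>j\<close> and both swapped colours
  differ from \<open>j\<close>, the two-coloured subgraphs of \<open>E - M\<close> and
  \<open>E\<close> are the same.\<close>

lemma kempe_step_lift:
  assumes step: "kempe_step (E - M) (C - {j}) f f'" and M: "\<And>e. e \<in> E \<Longrightarrow> f e = j \<longleftrightarrow> e \<in> M"
  shows "kempe_step E C f f' \<and> (\<forall>e\<in>E. f' e = j \<longleftrightarrow> e \<in> M)"
proof -
  obtain a b e0 where ab: "a \<in> C - {j}" "b \<in> C - {j}" "e0 \<in> two_col_edges (E - M) f a b"
    and f': "f' = flip a b (kempe_component (E - M) f a b e0) f"
    using step unfolding kempe_step_def by blast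
  have tc: "two_col_edges (E - M) f a b = two_col_edges E f a b"
    unfolding two_col_edges_def using M ab(1,2) by blast
  then have K: "kempe_component (E - M) f a b e0 = kempe_component E f a b e0"
    unfolding kempe_component_def by simp
  have "kempe_step E C f f'"
    unfolding kempe_step_def f' K using ab tc by blast
  moreover have "f' e = j \<longleftrightarrow> f e = j" for e
    using kempe_component_subset[of E f a b e0] ab(1,2)
    unfolding f' K flip_def swap_col_def two_col_edges_def by auto
  ultimately show ?thesis using M by blast
qed

lemma kempe_reachable_lift:
  assumes "(kempe_step (E - M) (C - {j}))\<^sup>*\<^sup>* f f'" and "\<And>e. e \<in> E \<Longrightarrow> f e = j \<longleftrightarrow> e \<in> M"
  shows "(kempe_step E C)\<^sup>*\<^sup>* f f' \<and> (\<forall>e\<in>E. f' e = j \<longleftrightarrow> e \<in> M)"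
  using assms(1)
proof (induction rule: rtranclp_induct)
  case base
  then show ?case using assms(2) by blast
next
  case (step g h)
  have "kempe_step E C g h \<and> (\<forall>e\<in>E. h e = j \<longleftrightarrow> e \<in> M)"
    by (rule kempe_step_lift[OF step.hyps(2)]) (use step.IH in blast)
  then show ?case using rtranclp.rtrancl_into_rtrancl[of "kempe_step E C" f g h] step.IH by blast
qed

text \<open>The degree and both colour sets vary, so that removing the class \<open>j\<close> of
  \<open>g\<close> yields an instance of the same statement.\<close>

theorem regular_kempe_reachable:
  assumes "simple_graph V E" "\<And>x. x \<in> V \<Longrightarrow> degree E x = k" "k \<le> 4"
    and "finite C" "card C = Suc k" "D \<subseteq> C" "card D = k" "coloring E C f" "coloring E D g"
  shows "\<exists>h. (kempe_step E C)\<^sup>*\<^sup>* f h \<and> (\<forall>e\<in>E. h e = g e)"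
  using assms
proof (induction k arbitrary: E C D f)
  case 0
  interpret near_regular V E C by unfold_locales (use 0 in auto)
  have "E = {}"
  proof (rule ccontr)
    assume "E \<noteq> {}"
    then obtain e x where "e \<in> E" "x \<in> e" "x \<in> V" using edge_pair by blast
    then have "card {e \<in> E. x \<in> e} = 0" using 0(2) unfolding degree_def by simp
    then show False using finite_E \<open>e \<in> E\<close> \<open>x \<in> e\<close> by auto
  qed
  then show ?case by blast
next
  case (Suc k)
  interpret near_regular V E C by unfold_locales (use Suc.prems in auto)
  have finD: "finite D" using Suc.prems(4,6) finite_subset by blast
  have "D \<noteq> {}" using Suc.prems(7) by auto
  then obtain j where j: "j \<in> D" by blast
  define M where "M = {e \<in> E. g e = j}"
  have inj: "inj_on g {e \<in> E. x \<in> e}" for x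
    using Suc.prems(9) unfolding inj_on_def coloring_def adj_edges_def by blast
  \<comment> \<open>The edges at \<open>x\<close> carry distinct colours of \<open>D\<close>, and
    there are as many edges as colours, so \<open>j\<close> occurs exactly once.\<close>
  have perfect: "\<exists>!e. e \<in> M \<and> x \<in> e" if x: "x \<in> V" for x
  proof -
    have "g ` {e \<in> E. x \<in> e} \<subseteq> D" using Suc.prems(9) unfolding coloring_def by blast
    moreover have "card (g ` {e \<in> E. x \<in> e}) = card D"
      using card_image[OF inj] Suc.prems(2)[OF x] Suc.prems(7) unfolding degree_def by simp
    ultimately have "g ` {e \<in> E. x \<in> e} = D" using card_subset_eq[OF finD] by blast
    then obtain e where "e \<in> E" "x \<in> e" "g e = j" using j by blast
    then show ?thesis
      unfolding M_def using inj_onD[OF inj[of x]] by (intro ex1I[of _ e]) auto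
  qed
  interpret near_regular_matching V E C M j
    by unfold_locales (use Suc.prems j perfect in \<open>auto simp: M_def\<close>)
  obtain f1 where f1: "reach f f1" "\<And>e. e \<in> E \<Longrightarrow> f1 e = j \<longleftrightarrow> e \<in> M"
    using reach_color_class[OF Suc.prems(8)] by blast
  have c1: "coloring E C f1" using kempe_reachable_coloring[OF f1(1) Suc.prems(8)] .
  have "\<exists>h. (kempe_step (E - M) (C - {j}))\<^sup>*\<^sup>* f1 h \<and> (\<forall>e\<in>E - M. h e = g e)"
  proof (rule Suc.IH)
    show "simple_graph V (E - M)" using Suc.prems(1) unfolding simple_graph_def by blast
    show "degree (E - M) x = k" if x: "x \<in> V" for x
    proof -
      obtain e where e: "e \<in> M" "x \<in> e" "\<And>e'. e' \<in> M \<Longrightarrow> x \<in> e' \<Longrightarrow> e' = e"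
        using perfect[OF x] by blast
      then have "{e' \<in> E - M. x \<in> e'} = {e' \<in> E. x \<in> e'} - {e}" by blast
      moreover have "e \<in> {e' \<in> E. x \<in> e'}" using e M_E by blast
      ultimately show ?thesis
        using Suc.prems(2)[OF x] finite_E unfolding degree_def by simp
    qed
    show "k \<le> 4" "finite (C - {j})" "D - {j} \<subseteq> C - {j}" using Suc.prems by auto
    show "card (C - {j}) = Suc k" "card (D - {j}) = k"
      using Suc.prems(4-7) finD j by (auto simp: card_Diff_singleton)
    show "coloring (E - M) (C - {j}) f1" using c1 f1(2) unfolding coloring_def by blast
    show "coloring (E - M) (D - {j}) g" using Suc.prems(9) unfolding coloring_def M_def by blast
  qed
  then obtain h where h: "(kempe_step (E - M) (C - {j}))\<^sup>*\<^sup>* f1 h" "\<forall>e\<in>E - M. h e = g e" by blast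
  have "reach f1 h" "\<forall>e\<in>E. h e = j \<longleftrightarrow> e \<in> M" using kempe_reachable_lift[OF h(1) f1(2)] by auto
  then have "reach f h" "\<forall>e\<in>E. h e = g e"
    using rtranclp_trans[OF f1(1)] h(2) unfolding M_def by auto
  then show ?case by blast
qed

text \<open>The case of degree four with target colours \<open>{1..4}\<close>. Agreement is asked on
  \<open>E\<close> only, as interchanges never alter values off \<open>E\<close>.\<close>

theorem theorem4p1:
  fixes V :: "'a set" and E :: "'a set set"
    and f g :: "'a set \<Rightarrow> nat"
  assumes "simple_graph V E"
    and "regular V E 4"
    and "chromatic_index E = 4"
    and "proper_edge_coloring E 5 f"
    and "proper_edge_coloring E 4 g"
  shows "\<exists>h. (interchange E 5)\<^sup>*\<^sup>* f h \<and> (\<forall>e\<in>E. h e = g e)"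
  unfolding interchange_eq_kempe_step
  by (rule regular_kempe_reachable[where k = 4 and D = "{1..4}", OF assms(1)])
    (use assms in \<open>auto simp: regular_def proper_edge_coloring_eq_coloring\<close>)

end
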